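(* Let $W\in\mathcal{DT}$ be an operator of diagonal type on $L^2(\mathbb T)$ with matrix $(W_{j,k})_{j,k\in\mathbb Z}$, and put $$\mathbf T(W)=\limsup_{\#I\to\infty}\frac1{\#I}\sum_{j\in\mathbb Z,\;l\in I}|W_{l,j}|^2,$$ where $I$ ranges over finite integer intervals. Then $\|W\|_\mu^2\ge\mathbf T(W)$.
   Context: $\mathbb T=\mathbb R/(2\pi\mathbb Z)$ with measure $d\mu=\frac1{2\pi}dx$, $\mathcal H=L^2(\mathbb T,\mu)$ (complex-valued). An operator $W$ on $\mathcal H$ is described by its matrix $(W_{j,k})_{j,k\in\mathbb Z}$ in the basis $e^{ikx}$: if $f=\sum_kf_ke^{ikx}$ then $Wf=\sum_{j}\big(\sum_kW_{j,k}f_k\big)e^{ijx}$. Put $c_k=\sup_{j\in\mathbb Z}|W_{k+j,j}|$. $W$ is of diagonal type, $W\in\mathcal{DT}$, if $\sum_{k\in\mathbb Z}c_k<\infty$ (such $W$ is bounded). An integer interval is a set $I=\{n,n+1,\dots,m\}\subset\mathbb Z$, $\#I=m-n+1$, and $\limsup_{\#I\to\infty}$ means $\lim_{N\to\infty}\sup_{\#I\ge N}$. For measurable $X\subset\mathbb T$, $\pi_Xf=\mathbf 1_Xf$. A partition is a finite family $\chi=\{Y_1,\dots,Y_J\}$ of measurable sets with $\mu(\mathbb T\setminus\bigcup_jY_j)=0$ and $\mu(Y_j\cap Y_k)=0$ for $j\ne k$. For a bounded operator $W$ on $\mathcal H$ with operator norm $\|W\|$, $\mathcal M_\chi(W)=\sum_{j=1}^J\mu(Y_j)\|W\pi_{Y_j}\|^2$,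 and the $\mu$-norm is $\|W\|_\mu=\inf_\chi\sqrt{\mathcal M_\chi(W)}$, the infimum being over all partitions $\chi$. *)

theory Defs
  imports "HOL-Analysis.Analysis"
begin

section \<open>The Hilbert space of square-integrable functions on the torus\<close>

text \<open>The torus is represented by its fundamental domain, with normalised Lebesgue measure.\<close>

definition torus :: "real measure" where
  "torus = density (lebesgue_on {0..<2 * pi}) (\<lambda>_. ennreal (1 / (2 * pi)))"

definition square_integrable :: "(real \<Rightarrow> complex) \<Rightarrow> bool" where
  "square_integrable f \<longleftrightarrow>
     f \<in> borel_measurable torus \<and> integrable torus (\<lambda>x. (cmod (f x))\<^sup>2)"

definition l2_eq :: "(real \<Rightarrow> complex) \<Rightarrow> (real \<Rightarrow> complex) \<Rightarrow> bool" where
  "l2_eq f g \<longleftrightarrow> square_integrable f \<and> square_integrable g \<and> (AE x in torus. f x = g x)"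

lemma space_torus [simp]: "space torus = {0..<2 * pi}"
  by (simp add: torus_def)

lemma sets_torus: "sets torus = sets (lebesgue_on {0..<2 * pi})"
  by (simp add: torus_def)

lemma emeasure_torus_space: "emeasure torus {0..<2 * pi} = 1"
proof -
  have S: "{0..<2 * pi} \<in> sets (lebesgue_on {0..<2 * pi})"
    using sets.top[of "lebesgue_on {0..<2 * pi}"] by simp
  have "emeasure torus {0..<2 * pi}
      = ennreal (1 / (2 * pi)) * emeasure (lebesgue_on {0..<2 * pi}) {0..<2 * pi}"
    unfolding torus_def using S by (simp add: emeasure_density nn_integral_cmult_indicator)
  also have "\<dots> = ennreal (1 / (2 * pi)) * ennreal (2 * pi)"
    by (simp add: emeasure_restrict_space)
  also have "\<dots> = 1"
    by (simp flip: ennreal_mult)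
  finally show ?thesis .
qed

lemma finite_measure_torus: "finite_measure torus"
  by (rule finite_measureI) (simp add: emeasure_torus_space)

lemma square_integrable_zero: "square_integrable (\<lambda>_. 0)"
  by (simp add: square_integrable_def)

lemma square_integrable_inner:
  assumes "square_integrable f" "square_integrable g"
  shows "integrable torus (\<lambda>x. f x \<bullet> g x)"
proof (rule Bochner_Integration.integrable_bound)
  show "integrable torus (\<lambda>x. (cmod (f x))\<^sup>2 + (cmod (g x))\<^sup>2)"
    using assms by (auto simp: square_integrable_def)
  show "(\<lambda>x. f x \<bullet> g x) \<in> borel_measurable torus"
    using assms by (auto simp: square_integrable_def)
  have "\<bar>a \<bullet> b\<bar> \<le> (cmod a)\<^sup>2 + (cmod b)\<^sup>2" for a b :: complex
  proof -
    have "\<bar>a \<bullet> b\<bar> \<le> cmod a * cmod b" by (rule Cauchy_Schwarz_ineq2)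
    also have "\<dots> \<le> (cmod a)\<^sup>2 + (cmod b)\<^sup>2"
      using sum_squares_bound[of "cmod a" "cmod b"]
        mult_nonneg_nonneg[OF norm_ge_zero[of a] norm_ge_zero[of b]]
      unfolding mult.assoc by linarith
    finally show ?thesis .
  qed
  then show "AE x in torus. norm (f x \<bullet> g x) \<le> norm ((cmod (f x))\<^sup>2 + (cmod (g x))\<^sup>2)"
    by simp
qed

lemma square_integrable_add:
  assumes "square_integrable f" "square_integrable g"
  shows "square_integrable (\<lambda>x. f x + g x)"
proof -
  have "(cmod (a + b))\<^sup>2 = (cmod a)\<^sup>2 + 2 * (a \<bullet> b) + (cmod b)\<^sup>2" for a b :: complex
    by (simp add: power2_norm_eq_inner inner_add_left inner_add_right inner_commute)
  then show ?thesis
    using assms square_integrable_inner[OF assms] by (auto simp: square_integrable_def)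
qed

lemma square_integrable_bounded_mult:
  assumes g: "square_integrable g" and h: "h \<in> borel_measurable torus"
    and b: "\<And>x. cmod (h x) \<le> B"
  shows "square_integrable (\<lambda>x. h x * g x)"
proof -
  have "integrable torus (\<lambda>x. (cmod (h x * g x))\<^sup>2)"
  proof (rule Bochner_Integration.integrable_bound)
    show "integrable torus (\<lambda>x. B\<^sup>2 * (cmod (g x))\<^sup>2)"
      using g by (auto simp: square_integrable_def)
    show "(\<lambda>x. (cmod (h x * g x))\<^sup>2) \<in> borel_measurable torus"
      using g h by (auto simp: square_integrable_def)
    show "AE x in torus. norm ((cmod (h x * g x))\<^sup>2) \<le> norm (B\<^sup>2 * (cmod (g x))\<^sup>2)"
      using b by (auto simp: norm_mult power_mult_distrib intro!: mult_right_mono power_mono)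
  qed
  then show ?thesis
    using g h by (auto simp: square_integrable_def)
qed

lemma square_integrable_cmult:
  "square_integrable f \<Longrightarrow> square_integrable (\<lambda>x. c * f x)"
  by (rule square_integrable_bounded_mult[where B = "cmod c"]) auto

lemma square_integrable_exp: "square_integrable (\<lambda>x. exp (\<i> * of_int k * of_real x))"
proof -
  interpret finite_measure torus by (rule finite_measure_torus)
  have "continuous_on UNIV (\<lambda>x::real. exp (\<i> * of_int k * of_real x))"
    by (intro continuous_intros)
  then have "(\<lambda>x::real. exp (\<i> * of_int k * of_real x)) \<in> borel_measurable lebesgue"
    by (intro measurable_completion) (auto intro: borel_measurable_continuous_onI)
  then have "(\<lambda>x::real. exp (\<i> * of_int k * of_real x)) \<in> borel_measurable torus"
    by (simp add: torus_def measurable_restrict_space1)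
  then show ?thesis
    by (simp add: square_integrable_def)
qed

lemma square_integrable_restrict:
  assumes "square_integrable f" "Y \<in> sets torus"
  shows "square_integrable (\<lambda>x. indicator Y x * f x)"
  by (rule square_integrable_bounded_mult[where B = 1])
    (use assms in \<open>auto simp: indicator_def\<close>)

quotient_type l2_torus = "real \<Rightarrow> complex" / partial: l2_eq
proof (rule part_equivpI)
  show "\<exists>f. l2_eq f f"
    using square_integrable_zero by (auto simp: l2_eq_def)
  show "symp l2_eq"
    by (auto simp: symp_def l2_eq_def)
  show "transp l2_eq"
    by (auto simp: transp_def l2_eq_def elim: AE_mp)
qed

text \<open>The real inner product below is the real part of the usual Hermitian one, so both induce
  the \<open>L\<^sup>2\<close> norm.\<close>

instantiation l2_torus :: real_inner
begin

lift_definition zero_l2_torus :: l2_torus is "\<lambda>_. 0"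
  by (simp add: l2_eq_def square_integrable_zero)

lift_definition plus_l2_torus :: "l2_torus \<Rightarrow> l2_torus \<Rightarrow> l2_torus" is "\<lambda>f g x. f x + g x"
  by (auto simp: l2_eq_def square_integrable_add elim: AE_mp)

lift_definition uminus_l2_torus :: "l2_torus \<Rightarrow> l2_torus" is "\<lambda>f x. - f x"
  by (auto simp: l2_eq_def square_integrable_def elim: AE_mp)

lift_definition minus_l2_torus :: "l2_torus \<Rightarrow> l2_torus \<Rightarrow> l2_torus" is "\<lambda>f g x. f x - g x"
  using square_integrable_add[OF _ square_integrable_cmult[where c = "-1"]]
  by (auto simp: l2_eq_def elim: AE_mp)

lift_definition scaleR_l2_torus :: "real \<Rightarrow> l2_torus \<Rightarrow> l2_torus" is "\<lambda>r f x. r *\<^sub>R f x"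
  by (auto simp: l2_eq_def scaleR_conv_of_real square_integrable_cmult elim: AE_mp)

lift_definition inner_l2_torus :: "l2_torus \<Rightarrow> l2_torus \<Rightarrow> real"
  is "\<lambda>f g. integral\<^sup>L torus (\<lambda>x. f x \<bullet> g x)"
proof -
  fix f f' g g' assume "l2_eq f f'" "l2_eq g g'"
  then show "integral\<^sup>L torus (\<lambda>x. f x \<bullet> g x) = integral\<^sup>L torus (\<lambda>x. f' x \<bullet> g' x)"
    by (intro integral_cong_AE) (auto simp: l2_eq_def square_integrable_def elim: AE_mp)
qed

lift_definition norm_l2_torus :: "l2_torus \<Rightarrow> real"
  is "\<lambda>f. sqrt (integral\<^sup>L torus (\<lambda>x. (cmod (f x))\<^sup>2))"
proof -
  fix f g assume "l2_eq f g"
  then have "integral\<^sup>L torus (\<lambda>x. (cmod (f x))\<^sup>2) = integral\<^sup>L torus (\<lambda>x. (cmod (g x))\<^sup>2)"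
    by (intro integral_cong_AE) (auto simp: l2_eq_def square_integrable_def elim: AE_mp)
  then show "sqrt (integral\<^sup>L torus (\<lambda>x. (cmod (f x))\<^sup>2))
      = sqrt (integral\<^sup>L torus (\<lambda>x. (cmod (g x))\<^sup>2))" by simp
qed

definition sgn_l2_torus :: "l2_torus \<Rightarrow> l2_torus" where
  "sgn_l2_torus f = inverse (norm f) *\<^sub>R f"

definition dist_l2_torus :: "l2_torus \<Rightarrow> l2_torus \<Rightarrow> real" where
  "dist_l2_torus f g = norm (f - g)"

definition uniformity_l2_torus :: "(l2_torus \<times> l2_torus) filter" where
  "uniformity_l2_torus = (INF e\<in>{0<..}. principal {(f, g). dist f g < e})"

definition open_l2_torus :: "l2_torus set \<Rightarrow> bool" where
  "open_l2_torus U \<longleftrightarrow> (\<forall>f\<in>U. eventually (\<lambda>(f', g). f' = f \<longrightarrow> g \<in> U) uniformity)"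

instance
proof
  fix f g h :: l2_torus and r s :: real
  show "f + g + h = f + (g + h)"
    by transfer (auto simp: l2_eq_def add.assoc square_integrable_add)
  show "f + g = g + f"
    by transfer (auto simp: l2_eq_def add.commute square_integrable_add)
  show "0 + f = f"
    by transfer (auto simp: l2_eq_def)
  show "- f + f = 0"
    by transfer (auto simp: l2_eq_def square_integrable_zero)
  show "f - g = f + - g"
    by transfer (use square_integrable_add[OF _ square_integrable_cmult[where c = "-1"]]
        in \<open>auto simp: l2_eq_def\<close>)
  show "r *\<^sub>R (f + g) = r *\<^sub>R f + r *\<^sub>R g"
    by transfer (auto simp: l2_eq_def scaleR_conv_of_real distrib_left
        square_integrable_add square_integrable_cmult)
  show "(r + s) *\<^sub>R f = r *\<^sub>R f + s *\<^sub>R f"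
    by transfer (use square_integrable_cmult in
        \<open>auto simp: l2_eq_def scaleR_conv_of_real distrib_right intro!: square_integrable_add\<close>)
  show "r *\<^sub>R s *\<^sub>R f = (r * s) *\<^sub>R f"
    by transfer (use square_integrable_cmult in
        \<open>auto simp: l2_eq_def scaleR_conv_of_real mult.assoc\<close>)
  show "1 *\<^sub>R f = f"
    by transfer (auto simp: l2_eq_def)
  show "sgn f = inverse (norm f) *\<^sub>R f"
    by (rule sgn_l2_torus_def)
  show "dist f g = norm (f - g)"
    by (rule dist_l2_torus_def)
  show "uniformity = (INF e\<in>{0<..}. principal {(f, g :: l2_torus). dist f g < e})"
    by (rule uniformity_l2_torus_def)
  show "open U \<longleftrightarrow> (\<forall>f\<in>U. eventually (\<lambda>(f', g). f' = f \<longrightarrow> g \<in> U) uniformity)"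
    for U :: "l2_torus set"
    by (rule open_l2_torus_def)
  show "f \<bullet> g = g \<bullet> f"
    by transfer (simp add: inner_commute)
  show "(f + g) \<bullet> h = f \<bullet> h + g \<bullet> h"
    by transfer (auto simp: l2_eq_def inner_add_left square_integrable_inner
        intro!: Bochner_Integration.integral_add)
  show "r *\<^sub>R f \<bullet> g = r * (f \<bullet> g)"
    by transfer simp
  show "0 \<le> f \<bullet> f"
    by transfer simp
  show "f \<bullet> f = 0 \<longleftrightarrow> f = 0"
  proof transfer
    fix f assume "l2_eq f f"
    then have f: "square_integrable f" by (simp add: l2_eq_def)
    have "integral\<^sup>L torus (\<lambda>x. f x \<bullet> f x) = 0 \<longleftrightarrow> (AE x in torus. f x \<bullet> f x = 0)"
      by (rule integral_nonneg_eq_0_iff_AE) (auto intro: square_integrable_inner f)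
    then show "integral\<^sup>L torus (\<lambda>x. f x \<bullet> f x) = 0 \<longleftrightarrow> l2_eq f (\<lambda>_. 0)"
      using f square_integrable_zero by (simp add: l2_eq_def)
  qed
  show "norm f = sqrt (f \<bullet> f)"
    by transfer (simp add: power2_norm_eq_inner)
qed

end

lift_definition scaleC :: "complex \<Rightarrow> l2_torus \<Rightarrow> l2_torus" (infixr "*\<^sub>C" 75)
  is "\<lambda>c f x. c * f x"
  by (auto simp: l2_eq_def square_integrable_cmult elim: AE_mp)

lift_definition fourier_mode :: "int \<Rightarrow> l2_torus"
  is "\<lambda>k x. exp (\<i> * of_int k * of_real x)"
  by (simp add: l2_eq_def square_integrable_exp)

text \<open>Multiplication by the indicator function of \<open>Y\<close>; the value for non-measurable \<open>Y\<close> is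
  irrelevant.\<close>

lift_definition restr :: "real set \<Rightarrow> l2_torus \<Rightarrow> l2_torus"
  is "\<lambda>Y f. if Y \<in> sets torus then (\<lambda>x. indicator Y x * f x) else (\<lambda>_. 0)"
  by (auto simp: l2_eq_def square_integrable_restrict square_integrable_zero elim: AE_mp)


section \<open>Operators of diagonal type\<close>

text \<open>Series in \<open>l2_torus\<close> converge in the \<open>L\<^sup>2\<close> norm.  Since every function has a Fourier expansion,
  the following forces \<open>W\<close> to be complex-linear and determines it uniquely from \<open>M\<close>.\<close>

definition has_matrix :: "(l2_torus \<Rightarrow> l2_torus) \<Rightarrow> (int \<Rightarrow> int \<Rightarrow> complex) \<Rightarrow> bool" where
  "has_matrix W M \<longleftrightarrow>
     (\<forall>f a. ((\<lambda>k. a k *\<^sub>C fourier_mode k) has_sum f) UNIV \<longrightarrow>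
        (\<exists>b. (\<forall>j. ((\<lambda>k. M j k * a k) has_sum b j) UNIV) \<and>
             ((\<lambda>j. b j *\<^sub>C fourier_mode j) has_sum W f) UNIV))"

definition diag_sup :: "(int \<Rightarrow> int \<Rightarrow> complex) \<Rightarrow> int \<Rightarrow> real" where
  "diag_sup M k = (SUP j. cmod (M (k + j) j))"

text \<open>Boundedness of each diagonal is required explicitly because \<open>diag_sup\<close> is a real
  supremum.\<close>

definition diagonal_type :: "(l2_torus \<Rightarrow> l2_torus) \<Rightarrow> (int \<Rightarrow> int \<Rightarrow> complex) \<Rightarrow> bool" where
  "diagonal_type W M \<longleftrightarrow> has_matrix W M \<and>
     (\<forall>k. bdd_above (range (\<lambda>j. cmod (M (k + j) j)))) \<and> diag_sup M summable_on UNIV"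


section \<open>The mu-norm\<close>

text \<open>A partition is a family indexed by \<open>{..<J}\<close>.  As \<open>onorm\<close> is a real supremum,
  \<open>mu_norm\<close> is meaningful for bounded \<open>W\<close>, which includes all operators of diagonal type.\<close>

definition torus_partition :: "nat \<Rightarrow> (nat \<Rightarrow> real set) \<Rightarrow> bool" where
  "torus_partition J Y \<longleftrightarrow>
     (\<forall>j<J. Y j \<in> sets torus) \<and>
     measure torus (space torus - (\<Union>j<J. Y j)) = 0 \<and>
     (\<forall>j<J. \<forall>k<J. j \<noteq> k \<longrightarrow> measure torus (Y j \<inter> Y k) = 0)"

definition partition_sum :: "nat \<Rightarrow> (nat \<Rightarrow> real set) \<Rightarrow> (l2_torus \<Rightarrow> l2_torus) \<Rightarrow> real" where
  "partition_sum J Y W = (\<Sum>j<J. measure torus (Y j) * (onorm (W \<circ> restr (Y j)))\<^sup>2)"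

definition mu_norm :: "(l2_torus \<Rightarrow> l2_torus) \<Rightarrow> real" where
  "mu_norm W = (INF (J, Y)\<in>{(J, Y). torus_partition J Y}. sqrt (partition_sum J Y W))"


section \<open>The averaged row norm\<close>

text \<open>All values are in \<open>ennreal\<close>, so that sums and suprema always exist.  The suprema decrease
  in \<open>N\<close>, hence the limit exists as well.\<close>

definition row_average :: "(int \<Rightarrow> int \<Rightarrow> complex) \<Rightarrow> int set \<Rightarrow> ennreal" where
  "row_average M I =
     (\<Sum>\<^sub>\<infinity>(j, l)\<in>UNIV \<times> I. ennreal ((cmod (M l j))\<^sup>2)) / of_nat (card I)"

definition limsup_row_average :: "(int \<Rightarrow> int \<Rightarrow> complex) \<Rightarrow> ennreal" where
  "limsup_row_average M =
     lim (\<lambda>N. SUP I\<in>{I. (\<exists>n m. n \<le> m \<and> I = {n..m}) \<and> card I \<ge> N}. row_average M I)"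

end

theory Submission
  imports Defs
begin

text \<open>
  With \<open>R\<^sub>l\<close> the function whose Fourier coefficients are the conjugated entries of the \<open>l\<close>-th row,
  \<open>\<langle>W \<pi>\<^sub>Y e\<^sub>k, e\<^sub>l\<rangle> = \<langle>e\<^sub>k, \<pi>\<^sub>Y R\<^sub>l\<rangle>\<close>.  For every \<open>k\<close> one has
  \<open>\<Sum>\<^sub>i \<parallel>W \<pi>\<^sub>i e\<^sub>k\<parallel>\<^sup>2 \<le> \<Sum>\<^sub>i \<mu>(Y\<^sub>i) \<parallel>W \<pi>\<^sub>i\<parallel>\<^sup>2\<close>.
  Sum this over \<open>k\<close> in the \<open>L\<close>-neighbourhood of an interval \<open>I\<close>, and bound the left
  side below by Bessel's inequality using only the modes \<open>l \<in> I\<close>.  Diagonal decay and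
  the square summability of the Fourier coefficients of indicators make \<open>\<pi>\<^sub>Y R\<^sub>l\<close> concentrated,
  uniformly in \<open>l\<close>, on the modes \<open>k\<close> with \<open>\<bar>k - l\<bar> \<le> L\<close>.  The left side is therefore at least
  \<open>\<Sum>\<^sub>l\<^sub>\<in>\<^sub>I \<Sum>\<^sub>i \<parallel>\<pi>\<^sub>i R\<^sub>l\<parallel>\<^sup>2 = \<Sum>\<^sub>l\<^sub>\<in>\<^sub>I \<parallel>R\<^sub>l\<parallel>\<^sup>2\<close> up to \<open>\<epsilon> #I\<close>, while the neighbourhood has
  only \<open>2 L\<close> more elements than \<open>I\<close>.
\<close>

section \<open>Fourier coefficients\<close>

lemma l2_eq_refl: "l2_eq f f \<longleftrightarrow> square_integrable f"
  by (simp add: l2_eq_def)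

lemma borel_measurable_torus_continuous:
  fixes f :: "real \<Rightarrow> 'a::{second_countable_topology,topological_space}"
  assumes "continuous_on UNIV f"
  shows "f \<in> borel_measurable torus"
proof -
  have "f \<in> borel_measurable lebesgue"
    by (intro measurable_completion) (auto intro: assms borel_measurable_continuous_onI)
  then show ?thesis
    by (simp add: torus_def measurable_restrict_space1)
qed

lemma exp_measurable_torus [measurable]:
  "(\<lambda>x. exp (\<i> * of_int k * complex_of_real x)) \<in> borel_measurable torus"
  using square_integrable_exp by (simp add: square_integrable_def)

lemma AE_torusI:
  assumes "AE x in lebesgue. x \<in> {0..<2 * pi} \<longrightarrow> P x"
  shows "AE x in torus. P x"
proof -
  have "AE x in lebesgue_on {0..<2 * pi}. P x"
    using assms by (subst AE_restrict_space_iff) auto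
  then show ?thesis
    unfolding torus_def by (subst AE_density) auto
qed

lemma square_integrable_bounded:
  assumes "f \<in> borel_measurable torus" "\<And>x. x \<in> space torus \<Longrightarrow> cmod (f x) \<le> B"
  shows "square_integrable f"
proof -
  interpret finite_measure torus by (rule finite_measure_torus)
  have "integrable torus (\<lambda>x. (cmod (f x))\<^sup>2)"
    using assms by (intro integrable_const_bound[where B = "B\<^sup>2"]) (auto intro!: AE_I2 power_mono)
  with assms show ?thesis by (simp add: square_integrable_def)
qed

text \<open>On a finite measure space square integrability implies integrability, by the pointwise
  bound \<open>t <= 1 + t^2\<close>; the factor of modulus 1 does not change this. It makes the
  coefficient integrals genuine.\<close>

lemma square_integrable_mult_exp:
  assumes "square_integrable f"
  shows "integrable torus (\<lambda>x. f x * exp (\<i> * of_int k * of_real x))"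
proof -
  interpret finite_measure torus by (rule finite_measure_torus)
  show ?thesis
  proof (rule Bochner_Integration.integrable_bound)
    show "integrable torus (\<lambda>x. 1 + (cmod (f x))\<^sup>2)"
      using assms by (simp add: square_integrable_def)
    show "(\<lambda>x. f x * exp (\<i> * of_int k * of_real x)) \<in> borel_measurable torus"
      using assms by (auto simp: square_integrable_def)
    have "cmod (f x) \<le> 1 + (cmod (f x))\<^sup>2" for x
    proof -
      have "2 * cmod (f x) \<le> 1 + (cmod (f x))\<^sup>2"
        using sum_squares_bound[of 1 "cmod (f x)"] by simp
      then show ?thesis using norm_ge_zero[of "f x"] by linarith
    qed
    then show "AE x in torus. norm (f x * exp (\<i> * of_int k * of_real x))
        \<le> norm (1 + (cmod (f x))\<^sup>2)"
      by (simp add: norm_mult)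
  qed
qed

lemma integral_exp_torus:
  "integral\<^sup>L torus (\<lambda>x. exp (\<i> * of_int k * of_real x)) = (if k = 0 then 1 else 0)"
proof (cases "k = 0")
  case True
  then show ?thesis
    using emeasure_torus_space by (simp add: measure_def)
next
  case False
  let ?f = "\<lambda>x::real. exp (\<i> * of_int k * complex_of_real x)"
  have c: "continuous_on UNIV ?f" by (intro continuous_intros)
  have "(?f has_integral (exp (\<i> * of_int k * of_real (2*pi)) / (\<i> * of_int k)
      - exp (\<i> * of_int k * of_real 0) / (\<i> * of_int k))) {0..2*pi}"
  proof (rule fundamental_theorem_of_calculus)
    fix x :: real
    have "((\<lambda>z. exp (\<i> * of_int k * z) / (\<i> * of_int k)) has_field_derivative ?f x)
        (at (of_real x))"
      using False by (auto intro!: derivative_eq_intros)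
    then show "((\<lambda>x. exp (\<i> * of_int k * complex_of_real x) / (\<i> * of_int k)) has_vector_derivative ?f x)
        (at x within {0..2*pi})"
      by (rule has_vector_derivative_real_field)
  qed auto
  moreover have "exp (\<i> * of_int k * complex_of_real (2*pi)) = 1"
    using exp_integer_2pi[of "of_int k"] by (simp add: mult_ac)
  ultimately have "(?f has_integral 0) {0..2*pi}" by simp
  then have "integral {0..2*pi} ?f = 0"
    by (rule integral_unique)
  moreover have "integrable (lebesgue_on {0..2*pi}) ?f"
    by (intro continuous_imp_integrable_real continuous_intros)
  ultimately have "integral\<^sup>L (lebesgue_on {0..2*pi}) ?f = 0"
    by (simp add: lebesgue_integral_eq_integral)
  \<comment> \<open>The fundamental theorem of calculus works on the closed interval,
    \<open>torus\<close> on the half-open one; they differ in the single null point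
    \<open>2 * pi\<close>.\<close>
  moreover have "AE x in lebesgue. x \<noteq> 2 * pi"
    by (intro AE_I[where N = "{2 * pi}"]) auto
  then have "AE x in lebesgue. indicat_real {0..2*pi} x *\<^sub>R ?f x
      = indicat_real {0..<2*pi} x *\<^sub>R ?f x"
    by eventually_elim (auto simp: indicator_def)
  moreover have "?f \<in> borel_measurable lebesgue"
    by (intro measurable_completion) (auto intro: c borel_measurable_continuous_onI)
  then have "(LINT x|lebesgue. indicat_real {0..2*pi} x *\<^sub>R ?f x)
      = (LINT x|lebesgue. indicat_real {0..<2*pi} x *\<^sub>R ?f x)"
    using calculation(2)
    by (intro integral_cong_AE borel_measurable_scaleR borel_measurable_indicator) auto
  ultimately have "integral\<^sup>L (lebesgue_on {0..<2*pi}) ?f = 0"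
    by (simp add: integral_restrict_space)
  moreover have "?f \<in> borel_measurable (lebesgue_on {0..<2*pi})"
    using exp_measurable_torus[of k] unfolding torus_def by simp
  ultimately show ?thesis
    using False unfolding torus_def by (subst integral_density) auto
qed

lift_definition coef :: "l2_torus \<Rightarrow> int \<Rightarrow> complex"
  is "\<lambda>f k. integral\<^sup>L torus (\<lambda>x. f x * exp (\<i> * of_int (- k) * of_real x))"
proof (rule ext, rule integral_cong_AE)
  fix f g :: "real \<Rightarrow> complex" and k
  assume "l2_eq f g"
  then show "(\<lambda>x. f x * exp (\<i> * of_int (- k) * of_real x)) \<in> borel_measurable torus"
     "(\<lambda>x. g x * exp (\<i> * of_int (- k) * of_real x)) \<in> borel_measurable torus"
     "AE x in torus. f x * exp (\<i> * of_int (- k) * of_real x)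
         = g x * exp (\<i> * of_int (- k) * of_real x)"
    by (auto simp: l2_eq_def square_integrable_def simp del: of_int_minus)
qed

lemma cnj_exp_mode: "cnj (exp (\<i> * of_int k * of_real x)) = exp (\<i> * of_int (- k) * of_real x)"
  by (simp add: exp_cnj)

lemma inner_conv_Re: "a \<bullet> b = Re (a * cnj b)" for a b :: complex
  by (simp add: inner_complex_def)

lemma inner_scaleC_fourier_mode: "f \<bullet> (c *\<^sub>C fourier_mode k) = Re (coef f k * cnj c)"
proof transfer
  fix f c k assume "l2_eq f f"
  then have f: "square_integrable f" by (simp add: l2_eq_def)
  let ?e = "\<lambda>x. exp (\<i> * of_int (-k) * complex_of_real x)"
  have i: "integrable torus (\<lambda>x. f x * ?e x * cnj c)"
    by (intro integrable_mult_left square_integrable_mult_exp f)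
  have "f x \<bullet> (c * exp (\<i> * of_int k * of_real x)) = Re (f x * ?e x * cnj c)" for x
    by (simp only: inner_conv_Re complex_cnj_mult cnj_exp_mode) (simp add: algebra_simps)
  then have "(LINT x|torus. f x \<bullet> (c * exp (\<i> * of_int k * of_real x)))
      = (LINT x|torus. Re (f x * ?e x * cnj c))"
    by simp
  also have "\<dots> = Re (LINT x|torus. f x * ?e x * cnj c)"
    using integral_Re[OF i] by simp
  finally show "(LINT x|torus. f x \<bullet> (c * exp (\<i> * of_int k * of_real x)))
      = Re ((LINT x|torus. f x * ?e x) * cnj c)"
    by simp
qed

text \<open>The inner product is the real part of the Hermitian one, so pairing with the mode gives
  the real part of the coefficient and pairing with \<open>\<i>\<close> times the mode gives the
  imaginary part. Bounded linearity of \<open>coef\<close> is read off from this form.\<close>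

lemma coef_eq_inner:
  "coef f k = of_real (f \<bullet> fourier_mode k) + \<i> * of_real (f \<bullet> (\<i> *\<^sub>C fourier_mode k))"
proof -
  have "1 *\<^sub>C fourier_mode k = fourier_mode k"
    by transfer (simp add: l2_eq_refl square_integrable_exp)
  then have "f \<bullet> fourier_mode k = Re (coef f k)"
    using inner_scaleC_fourier_mode[of f 1 k] by simp
  then show ?thesis
    by (simp add: inner_scaleC_fourier_mode complex_eq_iff)
qed

lemma bounded_linear_coef: "bounded_linear (\<lambda>f. coef f k)"
  unfolding coef_eq_inner
  by (intro bounded_linear_add bounded_linear_compose[OF bounded_linear_of_real]
     bounded_linear_compose[OF bounded_linear_mult_right] bounded_linear_inner_left)

lemma coef_scaleC: "coef (c *\<^sub>C f) k = c * coef f k"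
  by transfer (simp add: mult.assoc)

lemma coef_fourier_mode: "coef (fourier_mode j) k = (if j = k then 1 else 0)"
proof transfer
  fix j k
  have "exp (\<i> * of_int j * complex_of_real x) * exp (\<i> * of_int (- k) * of_real x)
     = exp (\<i> * of_int (j - k) * of_real x)" for x
    by (simp add: algebra_simps flip: exp_add)
  then show "(LINT x|torus. exp (\<i> * of_int j * complex_of_real x) * exp (\<i> * of_int (- k) * of_real x))
    = (if j = k then 1 else 0)"
    by (simp only: integral_exp_torus) simp
qed

section \<open>Complex scalars and restriction to a set\<close>

lemma scaleC_add_right: "c *\<^sub>C (f + g) = c *\<^sub>C f + c *\<^sub>C g"
  by transfer (simp add: l2_eq_refl distrib_left square_integrable_add square_integrable_cmult)

lemma scaleC_add_left: "(c + d) *\<^sub>C f = c *\<^sub>C f + d *\<^sub>C f"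
  by transfer (simp add: l2_eq_refl distrib_right square_integrable_add square_integrable_cmult)

lemma scaleC_scaleC: "c *\<^sub>C d *\<^sub>C f = (c * d) *\<^sub>C f"
  by transfer (simp add: l2_eq_refl mult.assoc square_integrable_cmult)

lemma scaleC_scaleR: "r *\<^sub>R f = complex_of_real r *\<^sub>C f"
  by transfer (simp add: l2_eq_refl scaleR_conv_of_real square_integrable_cmult)

lemma scaleC_zero: "0 *\<^sub>C f = 0"
  by transfer (simp add: l2_eq_refl square_integrable_zero)

lemma norm_scaleC: "norm (c *\<^sub>C f) = cmod c * norm f"
  by transfer (simp add: norm_mult power_mult_distrib real_sqrt_mult)

lemma restr_add: "restr Y (f + g) = restr Y f + restr Y g"
  by transfer (auto simp: l2_eq_refl square_integrable_zero distrib_left square_integrable_restrict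
      intro!: square_integrable_add)

lemma restr_scaleC: "restr Y (c *\<^sub>C f) = c *\<^sub>C restr Y f"
  by transfer (auto simp: l2_eq_refl square_integrable_zero mult.left_commute
      intro!: square_integrable_cmult square_integrable_restrict)

lemma norm_restr_le: "norm (restr Y f) \<le> norm f"
proof transfer
  fix Y f assume "l2_eq f f"
  then have f: "square_integrable f" by (simp add: l2_eq_refl)
  have "(LINT x|torus. (cmod (indicator Y x * f x))\<^sup>2) \<le> (LINT x|torus. (cmod (f x))\<^sup>2)"
      if "Y \<in> sets torus"
    using f square_integrable_restrict[OF f that]
    by (intro integral_mono) (auto simp: square_integrable_def indicator_def)
  then show "sqrt (LINT x|torus. (cmod ((if Y \<in> sets torus
      then (\<lambda>x. indicator Y x * f x) else (\<lambda>_. 0)) x))\<^sup>2)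
      \<le> sqrt (LINT x|torus. (cmod (f x))\<^sup>2)"
    by auto
qed

lemma bounded_linear_restr: "bounded_linear (restr Y)"
  by (rule bounded_linear_intro[where K = 1])
     (auto simp: restr_add scaleC_scaleR restr_scaleC norm_restr_le)

text \<open>Multiplication by an indicator has a Toeplitz matrix. This is what later makes
  truncation estimates uniform in the mode.\<close>

lemma coef_restr_fourier_mode:
  "coef (restr Y (fourier_mode j)) k = coef (restr Y (fourier_mode 0)) (k - j)"
proof transfer
  fix Y j k
  have "exp (\<i> * of_int j * complex_of_real x) * exp (\<i> * of_int (- k) * of_real x)
     = exp (\<i> * of_int 0 * of_real x) * exp (\<i> * of_int (- (k - j)) * of_real x)" for x
    by (simp add: algebra_simps flip: exp_add)
  then show "(LINT x|torus. (if Y \<in> sets torus then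
      (\<lambda>x. indicator Y x * exp (\<i> * of_int j * complex_of_real x)) else (\<lambda>_. 0)) x
      * exp (\<i> * of_int (- k) * of_real x)) =
    (LINT x|torus. (if Y \<in> sets torus then
      (\<lambda>x. indicator Y x * exp (\<i> * of_int 0 * complex_of_real x)) else (\<lambda>_. 0)) x
      * exp (\<i> * of_int (- (k - j)) * of_real x))"
    by (cases "Y \<in> sets torus") (simp_all only: mult.assoc if_True if_False mult_zero_left)
qed

text \<open>The indicator is real-valued, so multiplication by it is self-adjoint and its matrix is
  Hermitian.\<close>

lemma coef_restr_fourier_mode_swap:
  "coef (restr Y (fourier_mode j)) k = cnj (coef (restr Y (fourier_mode k)) j)"
proof transfer
  fix Y j k
  have "cnj (indicator Y x * exp (\<i> * of_int k * of_real x) * exp (\<i> * of_int (- j) * complex_of_real x))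
     = indicator Y x * exp (\<i> * of_int j * of_real x) * exp (\<i> * of_int (- k) * of_real x)" for x
    by (simp only: complex_cnj_mult cnj_exp_mode) (simp add: indicator_def)
  then show "(LINT x|torus. (if Y \<in> sets torus then
      (\<lambda>x. indicator Y x * exp (\<i> * of_int j * complex_of_real x)) else (\<lambda>_. 0)) x
      * exp (\<i> * of_int (- k) * of_real x)) =
    cnj (LINT x|torus. (if Y \<in> sets torus then
      (\<lambda>x. indicator Y x * exp (\<i> * of_int k * complex_of_real x)) else (\<lambda>_. 0)) x
      * exp (\<i> * of_int (- j) * of_real x))"
    by (simp flip: Bochner_Integration.integral_cnj)
qed

text \<open>Modes have modulus 1 everywhere. This is the source of the weights
  \<open>measure torus (Y j)\<close> in \<open>partition_sum\<close>.\<close>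

lemma norm_restr_fourier_mode:
  assumes "Y \<in> sets torus"
  shows "(norm (restr Y (fourier_mode k)))\<^sup>2 = measure torus Y"
  using assms
proof transfer
  fix Y k assume Y: "Y \<in> sets torus"
  have "(\<lambda>x. (cmod (indicator Y x * exp (\<i> * of_int k * complex_of_real x)))\<^sup>2) = indicat_real Y"
    by (auto simp: indicator_def)
  then show "(sqrt (LINT x|torus. (cmod ((if Y \<in> sets torus then
      (\<lambda>x. indicator Y x * exp (\<i> * of_int k * complex_of_real x)) else (\<lambda>_. 0)) x))\<^sup>2))\<^sup>2
          = measure torus Y"
    using Y sets.sets_into_space[OF Y] by (simp add: Int_absorb2 del: space_torus)
qed

text \<open>Almost every point lies in some \<open>Y i\<close>; there one summand already equals
  \<open>|f|^2\<close> and the others are nonnegative.\<close>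

lemma norm_le_sum_restr:
  assumes "torus_partition J Y"
  shows "(norm f)\<^sup>2 \<le> (\<Sum>i<J. (norm (restr (Y i) f))\<^sup>2)"
  using assms
proof transfer
  fix J and Y :: "nat \<Rightarrow> real set" and f assume P: "torus_partition J Y" and "l2_eq f f"
  then have f: "square_integrable f" by (simp add: l2_eq_refl)
  interpret finite_measure torus by (rule finite_measure_torus)
  have Y: "Y i \<in> sets torus" if "i < J" for i using P that by (simp add: torus_partition_def)
  have si: "integrable torus (\<lambda>x. (cmod (indicator (Y i) x * f x))\<^sup>2)" if "i < J" for i
    using square_integrable_restrict[OF f Y[OF that]] by (simp add: square_integrable_def)
  have "emeasure torus (space torus - (\<Union>j<J. Y j)) = 0"
    using P by (simp add: torus_partition_def emeasure_eq_measure)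
  then have "AE x in torus. x \<in> (\<Union>j<J. Y j)"
    using Y by (intro AE_I[where N = "space torus - (\<Union>j<J. Y j)"])
      (auto intro!: sets.Diff simp del: space_torus)
  then have "AE x in torus. (cmod (f x))\<^sup>2 \<le> (\<Sum>i<J. (cmod (indicator (Y i) x * f x))\<^sup>2)"
  proof (rule AE_mp, intro AE_I2 impI)
    fix x assume "x \<in> (\<Union>j<J. Y j)"
    then obtain i where "i < J" "x \<in> Y i" by auto
    then have "(cmod (f x))\<^sup>2 = (cmod (indicator (Y i) x * f x))\<^sup>2" by simp
    also have "\<dots> \<le> (\<Sum>i<J. (cmod (indicator (Y i) x * f x))\<^sup>2)"
      using \<open>i < J\<close> by (intro member_le_sum) auto
    finally show "(cmod (f x))\<^sup>2 \<le> (\<Sum>i<J. (cmod (indicator (Y i) x * f x))\<^sup>2)" .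
  qed
  then have "(LINT x|torus. (cmod (f x))\<^sup>2) \<le> (LINT x|torus. (\<Sum>i<J. (cmod (indicator (Y i) x * f x))\<^sup>2))"
    using f si by (intro integral_mono_AE) (auto simp: square_integrable_def)
  also have "\<dots> = (\<Sum>i<J. LINT x|torus. (cmod (indicator (Y i) x * f x))\<^sup>2)"
    using si by (intro Bochner_Integration.integral_sum) auto
  finally show "(sqrt (LINT x|torus. (cmod (f x))\<^sup>2))\<^sup>2 \<le>
      (\<Sum>i<J. (sqrt (LINT x|torus. (cmod ((if Y i \<in> sets torus then (\<lambda>x. indicator (Y i) x * f x)
        else (\<lambda>_. 0)) x))\<^sup>2))\<^sup>2)"
    using Y by simp
qed

section \<open>Density of trigonometric polynomials\<close>

inductive trig_poly :: "(real \<Rightarrow> complex) \<Rightarrow> bool" where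
  mode: "trig_poly (\<lambda>x. c * exp (\<i> * of_int k * of_real x))"
| add: "trig_poly p \<Longrightarrow> trig_poly q \<Longrightarrow> trig_poly (\<lambda>x. p x + q x)"

text \<open>Since \<open>c\<close> runs through all complex numbers, the real \<open>span\<close> is
  the complex span of the modes.\<close>

definition trig_space :: "l2_torus set" where
  "trig_space = span (range (\<lambda>(c, k). c *\<^sub>C fourier_mode k))"

lemma trig_poly_cmult: "trig_poly p \<Longrightarrow> trig_poly (\<lambda>x. c * p x)"
proof (induction rule: trig_poly.induct)
  case (mode d k)
  then show ?case using trig_poly.mode[of "c * d" k] by (simp add: mult.assoc)
qed (simp add: distrib_left trig_poly.add)

lemma trig_poly_mult_mode: "trig_poly p \<Longrightarrow> trig_poly (\<lambda>x. p x * (c * exp (\<i> * of_int k * of_real x)))"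
proof (induction rule: trig_poly.induct)
  case (mode d j)
  have "d * exp (\<i> * of_int j * of_real x) * (c * exp (\<i> * of_int k * of_real x))
     = d * c * exp (\<i> * of_int (j + k) * complex_of_real x)" for x
    by (simp add: algebra_simps exp_add)
  then show ?case using trig_poly.mode[of "d * c" "j + k"] by (simp only:)
qed (simp add: distrib_right trig_poly.add)

lemma trig_poly_mult: "trig_poly q \<Longrightarrow> trig_poly p \<Longrightarrow> trig_poly (\<lambda>x. p x * q x)"
  by (induction rule: trig_poly.induct)
     (auto simp: distrib_left intro: trig_poly.add trig_poly_mult_mode)

lemma trig_poly_in_trig_space:
  "trig_poly p \<Longrightarrow> square_integrable p \<and> abs_l2_torus p \<in> trig_space"
proof (induction rule: trig_poly.induct)
  case (mode c k)
  have "abs_l2_torus (\<lambda>x. c * exp (\<i> * of_int k * of_real x)) = c *\<^sub>C fourier_mode k"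
    by (simp add: fourier_mode.abs_eq scaleC.abs_eq l2_eq_refl square_integrable_exp)
  moreover have "c *\<^sub>C fourier_mode k \<in> trig_space"
    unfolding trig_space_def by (intro span_base) auto
  ultimately show ?case
    by (simp add: square_integrable_cmult square_integrable_exp)
next
  case (add p q)
  then have "abs_l2_torus (\<lambda>x. p x + q x) = abs_l2_torus p + abs_l2_torus q"
    by (simp add: plus_l2_torus.abs_eq l2_eq_refl)
  with add show ?case
    by (auto simp: trig_space_def square_integrable_add intro: span_add)
qed

text \<open>The bridge from polynomial approximation on the unit circle to modes. A real linear
  functional takes the value \<open>cos x * g 1 + sin x * g \<i>\<close> at the point of angle
  \<open>x\<close>, a combination of the modes 1 and -1; sums and products stay within
  \<open>trig_poly\<close>.\<close>

lemma trig_poly_real_polynomial: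
  "real_polynomial_function g \<Longrightarrow> trig_poly (\<lambda>x. of_real (g (exp (\<i> * of_real x))))"
proof (induction rule: real_polynomial_function.induct)
  case (linear g)
  have c: "complex_of_real (g (exp (\<i> * of_real x)))
     = (of_real (g 1) / 2 + of_real (g \<i>) / (2 * \<i>)) * exp (\<i> * of_int 1 * of_real x)
     + (of_real (g 1) / 2 - of_real (g \<i>) / (2 * \<i>)) * exp (\<i> * of_int (-1) * of_real x)" for x
  proof -
    interpret bounded_linear g by fact
    have "exp (\<i> * of_real x) = cos x *\<^sub>R 1 + sin x *\<^sub>R \<i>"
      by (simp add: complex_eq_iff Re_exp Im_exp)
    then have "g (exp (\<i> * of_real x)) = cos x * g 1 + sin x * g \<i>"
      by (simp only: add scaleR real_scaleR_def)
    moreover have "exp (\<i> * of_int 1 * of_real x) = of_real (cos x) + \<i> * of_real (sin x)"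
      by (simp add: complex_eq_iff Re_exp Im_exp)
    moreover have "exp (\<i> * of_int (-1) * of_real x) = of_real (cos x) - \<i> * of_real (sin x)"
      by (simp add: complex_eq_iff Re_exp Im_exp)
    ultimately show ?thesis
      by (simp only:) (simp add: field_simps)
  qed
  show ?case unfolding c by (intro trig_poly.intros)
next
  case (const c)
  show ?case using trig_poly.mode[of "of_real c" 0] by simp
next
  case (add f g)
  then show ?case by (simp add: trig_poly.add)
next
  case (mult f g)
  then show ?case using trig_poly_mult by simp
qed

section \<open>Approximation in the L2 norm\<close>

lemma abs_rep_l2_torus: "abs_l2_torus (rep_l2_torus f) = f"
  by (rule Quotient3_abs_rep[OF Quotient3_l2_torus])

lemma square_integrable_rep: "square_integrable (rep_l2_torus f)"
  using Quotient3_rep_reflp[OF Quotient3_l2_torus] by (simp add: l2_eq_refl)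

lemma norm_abs_diff:
  assumes "square_integrable f" "square_integrable g"
  shows "norm (abs_l2_torus f - abs_l2_torus g) = sqrt (LINT x|torus. (cmod (f x - g x))\<^sup>2)"
proof -
  have "square_integrable (\<lambda>x. f x - g x)"
    using square_integrable_add[OF assms(1) square_integrable_cmult[where c = "-1", OF assms(2)]]
        by simp
  then show ?thesis
    using assms by (simp add: minus_l2_torus.abs_eq norm_l2_torus.abs_eq l2_eq_refl)
qed

lemma tendsto_l2_dominated:
  assumes fn: "\<And>n. square_integrable (fn n)" and f: "square_integrable f"
    and w: "integrable torus (\<lambda>x. (w x)\<^sup>2)"
    and lim: "AE x in torus. (\<lambda>n. fn n x) \<longlonglongrightarrow> f x"
    and bound: "\<And>n x. x \<in> space torus \<Longrightarrow> cmod (fn n x) \<le> w x"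
  shows "(\<lambda>n. abs_l2_torus (fn n)) \<longlonglongrightarrow> abs_l2_torus f"
proof -
  have [measurable]: "fn n \<in> borel_measurable torus" "f \<in> borel_measurable torus" for n
    using fn f by (simp_all add: square_integrable_def)
  have "(\<lambda>n. LINT x|torus. (cmod (fn n x - f x))\<^sup>2) \<longlonglongrightarrow> (LINT x|torus. 0)"
  proof (rule integral_dominated_convergence)
    show "integrable torus (\<lambda>x. 4 * (w x)\<^sup>2)" using w by simp
    show "AE x in torus. (\<lambda>n. (cmod (fn n x - f x))\<^sup>2) \<longlonglongrightarrow> 0"
      using lim by eventually_elim (auto intro!: tendsto_eq_intros simp: LIM_zero_iff)
    show "AE x in torus. norm ((cmod (fn n x - f x))\<^sup>2) \<le> 4 * (w x)\<^sup>2" for n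
      using lim AE_space
    proof eventually_elim
      case (elim x)
      \<comment> \<open>The limit inherits the bound \<open>w\<close>, so the difference is at most
        \<open>2 * w\<close> and its square at most the majorant \<open>4 * w^2\<close>.\<close>
      have "cmod (f x) \<le> w x"
        using elim bound by (intro LIMSEQ_le_const2[OF tendsto_norm[OF elim(1)]]) auto
      with bound[OF elim(2), of n] have "cmod (fn n x - f x) \<le> 2 * w x"
        using norm_triangle_ineq4[of "fn n x" "f x"] by linarith
      from power_mono[OF this norm_ge_zero, of 2] show ?case
        by (simp add: power_mult_distrib)
    qed
  qed measurable
  then have "(\<lambda>n. sqrt (LINT x|torus. (cmod (fn n x - f x))\<^sup>2)) \<longlonglongrightarrow> sqrt 0"
    by (intro tendsto_real_sqrt) simp
  then show ?thesis
    unfolding tendsto_iff dist_norm norm_abs_diff[OF fn f] by simp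
qed

text \<open>On the closed upper half circle the argument of \<open>z\<close> is \<open>arccos (Re z)\<close>, on the lower one it
  is \<open>2 * pi - arccos (Re z)\<close>.\<close>

lemma periodic_continuous_lift:
  fixes f :: "real \<Rightarrow> 'a::topological_space"
  assumes f: "continuous_on UNIV f" and per: "f 0 = f (2 * pi)"
  obtains F :: "complex \<Rightarrow> 'a" where "continuous_on (sphere 0 1) F"
    "\<And>x. x \<in> {0..<2 * pi} \<Longrightarrow> F (exp (\<i> * of_real x)) = f x"
proof
  let ?F = "\<lambda>z. if Im z \<ge> 0 then f (arccos (Re z)) else f (2 * pi - arccos (Re z))"
  have Re: "Re z \<in> {-1..1}" if "cmod z = 1" for z
    using abs_Re_le_cmod[of z] that by auto
  have "continuous_on (({z. Im z \<ge> 0} \<inter> sphere 0 1) \<union> ({z. Im z \<le> 0} \<inter> sphere 0 1)) ?F"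
  proof (rule continuous_on_cases)
    show "closed ({z. Im z \<ge> 0} \<inter> sphere 0 1)" "closed ({z. Im z \<le> 0} \<inter> sphere 0 1)"
      by (auto intro!: closed_Int closed_halfspace_Im_ge closed_halfspace_Im_le)
    have "continuous_on ({z. Im z \<ge> 0} \<inter> sphere 0 1) (f \<circ> (\<lambda>z. arccos (Re z)))"
      using Re by (intro continuous_on_compose continuous_intros continuous_on_subset[OF f]) auto
    then show "continuous_on ({z. Im z \<ge> 0} \<inter> sphere 0 1) (\<lambda>z. f (arccos (Re z)))"
      by (simp add: o_def)
    have "continuous_on ({z. Im z \<le> 0} \<inter> sphere 0 1) (f \<circ> (\<lambda>z. 2 * pi - arccos (Re z)))"
      using Re by (intro continuous_on_compose continuous_intros continuous_on_subset[OF f]) auto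
    then show "continuous_on ({z. Im z \<le> 0} \<inter> sphere 0 1) (\<lambda>z. f (2 * pi - arccos (Re z)))"
      by (simp add: o_def)
    \<comment> \<open>The two half circles meet only at 1 and -1. At -1 both arguments are
      \<open>pi\<close>; at 1 they are 0 and \<open>2 * pi\<close>, where periodicity
      enters.\<close>
    have "f (arccos (Re z)) = f (2 * pi - arccos (Re z))" if "Im z = 0" "cmod z = 1" for z
    proof -
      have "Re z = 1 \<or> Re z = -1"
        using that by (simp add: cmod_def) arith
      then show ?thesis using per by (auto simp: arccos_1 arccos_minus_1)
    qed
    then show "\<forall>z. z \<in> {z. Im z \<ge> 0} \<inter> sphere 0 1 \<and> \<not> Im z \<ge> 0
        \<or> z \<in> {z. Im z \<le> 0} \<inter> sphere 0 1 \<and> Im z \<ge> 0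
        \<longrightarrow> f (arccos (Re z)) = f (2 * pi - arccos (Re z))"
      by auto
  qed
  moreover have "({z. Im z \<ge> 0} \<inter> sphere 0 1) \<union> ({z. Im z \<le> 0} \<inter> sphere 0 1)
      = sphere (0::complex) 1"
    by auto
  ultimately show "continuous_on (sphere 0 1) ?F" by simp
  show "?F (exp (\<i> * of_real x)) = f x" if x: "x \<in> {0..<2 * pi}" for x
  proof (cases "x \<le> pi")
    case True
    with x have "sin x \<ge> 0" by (intro sin_ge_zero) auto
    with x True show ?thesis by (simp add: Re_exp Im_exp arccos_cos)
  next
    case False
    have "sin (x - pi) > 0"
      using x False by (intro sin_gt_zero) auto
    then have "sin x < 0" by (simp add: sin_diff)
    moreover have "arccos (cos x) = 2 * pi - x"
      using arccos_cos[of "2 * pi - x"] x False by (simp add: cos_diff)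
    ultimately show ?thesis by (simp add: Re_exp Im_exp)
  qed
qed

text \<open>A periodic continuous function lives on the unit circle, where Stone-Weierstrass
  approximates its real and imaginary parts within \<open>e / 4\<close> each. The total mass is 1,
  so the uniform error \<open>e / 2\<close> also bounds the L2 error.\<close>

lemma closure_trig_periodic:
  assumes f: "continuous_on UNIV f" and per: "f 0 = f (2 * pi)" and sq: "square_integrable f"
  shows "abs_l2_torus f \<in> closure trig_space"
  unfolding closure_approachable
proof (intro allI impI)
  fix e :: real assume e: "e > 0"
  obtain F where F: "continuous_on (sphere 0 1) F"
    and Ff: "\<And>x. x \<in> {0..<2 * pi} \<Longrightarrow> F (exp (\<i> * of_real x)) = f x"
    using periodic_continuous_lift[OF f per] by blast
  obtain g where g: "real_polynomial_function g"
    and g': "\<And>z. z \<in> sphere 0 1 \<Longrightarrow> \<bar>Re (F z) - g z\<bar> < e / 4"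
    using Stone_Weierstrass_real_polynomial_function[of "sphere 0 1" "\<lambda>z. Re (F z)" "e / 4"] e F
    by (auto intro: continuous_intros)
  obtain h where h: "real_polynomial_function h"
    and h': "\<And>z. z \<in> sphere 0 1 \<Longrightarrow> \<bar>Im (F z) - h z\<bar> < e / 4"
    using Stone_Weierstrass_real_polynomial_function[of "sphere 0 1" "\<lambda>z. Im (F z)" "e / 4"] e F
    by (auto intro: continuous_intros)
  define p where "p x = of_real (g (exp (\<i> * of_real x))) + \<i> * of_real (h (exp (\<i> * of_real x)))" for x
  have "trig_poly p"
    unfolding p_def by (intro trig_poly.add trig_poly_cmult trig_poly_real_polynomial g h)
  then have p: "square_integrable p" "abs_l2_torus p \<in> trig_space"
    using trig_poly_in_trig_space by auto
  interpret finite_measure torus by (rule finite_measure_torus)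
  have "cmod (p x - f x) \<le> e / 2" if x: "x \<in> {0..<2*pi}" for x
  proof -
    have "exp (\<i> * of_real x) \<in> sphere 0 1" by simp
    then have "\<bar>Re (f x) - g (exp (\<i> * of_real x))\<bar> < e / 4" "\<bar>Im (f x) - h (exp (\<i> * of_real x))\<bar> < e / 4"
      using g' h' Ff[OF x] by metis+
    then show ?thesis
      using cmod_le[of "p x - f x"] by (simp add: p_def abs_minus_commute)
  qed
  then have *: "(cmod (p x - f x))\<^sup>2 \<le> (e / 2)\<^sup>2" if "x \<in> space torus" for x
    using that by (intro power_mono) auto
  have sq': "square_integrable (\<lambda>x. p x - f x)"
    using square_integrable_add[OF p(1) square_integrable_cmult[where c = "-1", OF sq]] by simp
  have "(LINT x|torus. (cmod (p x - f x))\<^sup>2) \<le> (LINT x|torus. (e / 2)\<^sup>2)"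
    using * sq' by (intro integral_mono) (auto simp: square_integrable_def)
  also have "\<dots> = (e / 2)\<^sup>2"
    using emeasure_torus_space by (simp add: measure_def)
  finally have "norm (abs_l2_torus p - abs_l2_torus f) \<le> e / 2"
    unfolding norm_abs_diff[OF p(1) sq] using e by (intro real_le_lsqrt) auto
  then show "\<exists>y\<in>trig_space. dist y (abs_l2_torus f) < e"
    using p(2) e by (intro bexI[of _ "abs_l2_torus p"]) (auto simp: dist_norm)
qed

text \<open>Almost everywhere \<open>f\<close> is a limit of continuous functions
  \<open>g n\<close>. They are modified to be uniformly bounded, for dominated convergence, and to
  agree at both ends of the period, so that the periodic case applies.\<close>

lemma closure_trig_bounded:
  assumes f: "f \<in> borel_measurable torus" and B: "\<And>x. cmod (f x) \<le> B"
  shows "abs_l2_torus f \<in> closure trig_space"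
proof -
  have B0: "B \<ge> 0" using B[of 0] norm_ge_zero order_trans by blast
  have "f \<in> borel_measurable (lebesgue_on {0..<2*pi})"
    using f unfolding torus_def by simp
  then have "f measurable_on {0..<2*pi}"
    by (simp add: measurable_on_iff_borel_measurable)
  then obtain N g where N: "negligible N" and g: "\<And>n. continuous_on UNIV (g n)"
    and lim: "\<And>x. x \<notin> N \<Longrightarrow> (\<lambda>n. g n x) \<longlonglongrightarrow> (if x \<in> {0..<2*pi} then f x else 0)"
    unfolding measurable_on_def by auto
  \<comment> \<open>The nearest-point map onto the ball of radius \<open>B\<close> enforces the
    bound, is continuous, and fixes every value of \<open>f\<close>.\<close>
  define P where "P = closest_point (cball (0::complex) B)"
  have contP: "continuous_on UNIV P"
    unfolding P_def using B0 by (intro continuous_on_closest_point) auto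
  have Pb: "cmod (P z) \<le> B" for z
    using closest_point_in_set[of "cball (0::complex) B" z] B0 by (auto simp: P_def)
  have Pf: "P (f x) = f x" for x
    using B by (auto simp: P_def closest_point_self)
  \<comment> \<open>A trapezoid vanishing at 0 and at \<open>2 * pi\<close>, which forces equal end
    values, and tending to 1 in between.\<close>
  define cut where "cut n x = max 0 (min 1 (min (real n * x) (real n * (2 * pi - x))))" for n x
  define h where "h n x = of_real (cut n x) * P (g n x)" for n x
  have conth: "continuous_on UNIV (h n)" for n
    unfolding h_def cut_def
    by (intro continuous_intros continuous_on_compose2[OF contP g]) auto
  have hb: "cmod (h n x) \<le> B" for n x
  proof -
    have "cmod (h n x) \<le> 1 * B"
      unfolding h_def norm_mult by (intro mult_mono Pb) (auto simp: cut_def)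
    then show ?thesis by simp
  qed
  have hsq: "square_integrable (h n)" for n
    using hb by (intro square_integrable_bounded borel_measurable_torus_continuous conth)
  have "h n 0 = h n (2 * pi)" for n
    by (simp add: h_def cut_def)
  then have "abs_l2_torus (h n) \<in> closure trig_space" for n
    by (intro closure_trig_periodic conth hsq)
  moreover have "(\<lambda>n. abs_l2_torus (h n)) \<longlonglongrightarrow> abs_l2_torus f"
  proof (rule tendsto_l2_dominated[where w = "\<lambda>_. B"])
    show "square_integrable f" using f B by (intro square_integrable_bounded)
    \<comment> \<open>The point 0 is excluded together with \<open>N\<close> because
      \<open>cut n 0 = 0\<close> for all \<open>n\<close>.\<close>
    have pointwise: "(\<lambda>n. h n x) \<longlonglongrightarrow> f x" if x: "x \<in> {0..<2*pi}" "x \<notin> insert 0 N" for x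
    proof -
      have pos: "min x (2 * pi - x) > 0" using x by auto
      have "(\<lambda>n. P (g n x)) \<longlonglongrightarrow> P (f x)"
        using lim[of x] x by (intro continuous_on_tendsto_compose[OF contP]) auto
      moreover have "\<forall>\<^sub>F n in sequentially. cut n x = 1"
      proof -
        obtain n0 where n0: "real n0 * min x (2 * pi - x) > 1"
          using reals_Archimedean3[OF pos] by blast
        have "cut n x = 1" if "n \<ge> n0" for n
        proof -
          have "real n * min x (2 * pi - x) \<ge> real n0 * min x (2 * pi - x)"
            using that pos by (intro mult_right_mono) auto
          moreover have "real n * min x (2 * pi - x) \<le> real n * x"
            "real n * min x (2 * pi - x) \<le> real n * (2 * pi - x)"
            by (intro mult_left_mono; simp)+
          ultimately have "real n * x > 1" "real n * (2 * pi - x) > 1"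
            using n0 by linarith+
          then show ?thesis unfolding cut_def by simp
        qed
        then show ?thesis by (auto simp: eventually_sequentially)
      qed
      then have "(\<lambda>n. cut n x) \<longlonglongrightarrow> 1"
        by (rule tendsto_eventually)
      ultimately have "(\<lambda>n. of_real (cut n x) * P (g n x)) \<longlonglongrightarrow> of_real 1 * P (f x)"
        by (intro tendsto_intros)
      then show ?thesis by (simp add: h_def Pf)
    qed
    have "negligible (insert 0 N)" using N by simp
    then have "AE x in lebesgue. x \<notin> insert 0 N"
      by (intro AE_not_in) (simp add: negligible_iff_null_sets)
    then have "AE x in lebesgue. x \<in> {0..<2 * pi} \<longrightarrow> (\<lambda>n. h n x) \<longlonglongrightarrow> f x"
      by eventually_elim (use pointwise in blast)
    then show "AE x in torus. (\<lambda>n. h n x) \<longlonglongrightarrow> f x"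
      by (rule AE_torusI)
    interpret finite_measure torus by (rule finite_measure_torus)
    show "integrable torus (\<lambda>x. B\<^sup>2)" by simp
  qed (use hsq hb in auto)
  ultimately show ?thesis
    by (rule closed_sequentially[OF closed_closure])
qed

text \<open>An arbitrary \<open>f\<close> is the L2 limit of its truncations by size, which are
  bounded functions dominated by \<open>|f|\<close>.\<close>

lemma closure_trig_space: "closure trig_space = UNIV"
proof -
  have "F \<in> closure trig_space" for F
  proof -
    define f where "f = rep_l2_torus F"
    have f: "square_integrable f" unfolding f_def by (rule square_integrable_rep)
    then have fm [measurable]: "f \<in> borel_measurable torus" by (simp add: square_integrable_def)
    define h where "h n x = (if cmod (f x) \<le> real n then f x else 0)" for n x
    have hm: "h n \<in> borel_measurable torus" for n
      unfolding h_def by measurable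
    have hb: "cmod (h n x) \<le> real n" for n x by (simp add: h_def)
    have "abs_l2_torus (h n) \<in> closure trig_space" for n
      using hm hb by (rule closure_trig_bounded)
    moreover have "(\<lambda>n. abs_l2_torus (h n)) \<longlonglongrightarrow> abs_l2_torus f"
    proof (rule tendsto_l2_dominated[where w = "\<lambda>x. cmod (f x)"])
      show "square_integrable (h n)" for n
        using hm hb by (rule square_integrable_bounded)
      show "AE x in torus. (\<lambda>n. h n x) \<longlonglongrightarrow> f x"
      proof (intro AE_I2 tendsto_eventually)
        fix x
        obtain n0 where "cmod (f x) \<le> real n0" using real_arch_simple by blast
        then have "h n x = f x" if "n \<ge> n0" for n
          using that by (simp add: h_def)
        then show "\<forall>\<^sub>F n in sequentially. h n x = f x"
          by (auto simp: eventually_sequentially)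
      qed
    qed (use f in \<open>auto simp: square_integrable_def h_def\<close>)
    ultimately have "abs_l2_torus f \<in> closure trig_space"
      by (rule closed_sequentially[OF closed_closure])
    then show ?thesis by (simp add: f_def abs_rep_l2_torus)
  qed
  then show ?thesis by auto
qed

section \<open>Fourier expansion\<close>

lemma bounded_linear_scaleC: "bounded_linear (\<lambda>f. c *\<^sub>C f)"
  by (rule bounded_linear_intro[where K = "cmod c"])
     (auto simp: scaleC_add_right scaleC_scaleR scaleC_scaleC norm_scaleC mult.commute)

text \<open>For finite \<open>F\<close>, the orthogonal projection onto the complex span of the
  modes in \<open>F\<close>.\<close>

definition fproj :: "int set \<Rightarrow> l2_torus \<Rightarrow> l2_torus" where
  "fproj F f = (\<Sum>k\<in>F. coef f k *\<^sub>C fourier_mode k)"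

lemma bounded_linear_scaleC_left: "bounded_linear (\<lambda>c. c *\<^sub>C f)"
  by (rule bounded_linear_intro[where K = "norm f"])
     (auto simp: scaleC_add_left scaleC_scaleR scaleC_scaleC scaleR_conv_of_real norm_scaleC)

lemma bounded_linear_fproj: "bounded_linear (fproj F)"
  unfolding fproj_def
  by (intro bounded_linear_sum bounded_linear_compose[OF bounded_linear_scaleC_left] bounded_linear_coef)

lemma coef_sum: "coef (\<Sum>i\<in>F. f i) k = (\<Sum>i\<in>F. coef (f i) k)"
  by (rule linear_sum[OF bounded_linear.linear[OF bounded_linear_coef]])

lemma coef_sum_modes:
  assumes "finite F"
  shows "coef (\<Sum>k\<in>F. a k *\<^sub>C fourier_mode k) j = (if j \<in> F then a j else 0)"
  using assms by (simp add: coef_sum coef_scaleC coef_fourier_mode if_distrib[of "\<lambda>x. _ * x"] cong: if_cong)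

lemma inner_sum_modes:
  "f \<bullet> (\<Sum>k\<in>F. a k *\<^sub>C fourier_mode k) = (\<Sum>k\<in>F. Re (coef f k * cnj (a k)))"
  by (simp add: inner_sum_right inner_scaleC_fourier_mode)

lemma norm_sum_modes:
  assumes "finite F"
  shows "(norm (\<Sum>k\<in>F. a k *\<^sub>C fourier_mode k))\<^sup>2 = (\<Sum>k\<in>F. (cmod (a k))\<^sup>2)"
proof -
  have "(norm (\<Sum>k\<in>F. a k *\<^sub>C fourier_mode k))\<^sup>2
     = (\<Sum>k\<in>F. Re (coef (\<Sum>k\<in>F. a k *\<^sub>C fourier_mode k) k * cnj (a k)))"
    by (simp add: power2_norm_eq_inner inner_sum_modes)
  also have "\<dots> = (\<Sum>k\<in>F. (cmod (a k))\<^sup>2)"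
    using assms by (intro sum.cong) (auto simp: coef_sum_modes complex_norm_square[symmetric] simp flip: of_real_power)
  finally show ?thesis .
qed

text \<open>Pythagoras: \<open>f \<bullet> fproj F f\<close> and the squared norm of
  \<open>fproj F f\<close> are the same sum.\<close>

lemma norm_diff_fproj:
  assumes "finite F"
  shows "(norm (f - fproj F f))\<^sup>2 = (norm f)\<^sup>2 - (\<Sum>k\<in>F. (cmod (coef f k))\<^sup>2)"
proof -
  have "f \<bullet> fproj F f = (\<Sum>k\<in>F. (cmod (coef f k))\<^sup>2)"
    by (simp add: fproj_def inner_sum_modes complex_norm_square[symmetric] flip: of_real_power)
  moreover have "(norm (fproj F f))\<^sup>2 = (\<Sum>k\<in>F. (cmod (coef f k))\<^sup>2)"
    using assms by (simp add: fproj_def norm_sum_modes)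
  ultimately show ?thesis
    by (simp add: power2_norm_eq_inner inner_diff_left inner_diff_right inner_commute)
qed

lemma norm_diff_fproj_le:
  assumes "finite F"
  shows "norm (f - fproj F f) \<le> norm f"
proof (rule power2_le_imp_le)
  have "0 \<le> (\<Sum>k\<in>F. (cmod (coef f k))\<^sup>2)" by (intro sum_nonneg) auto
  then show "(norm (f - fproj F f))\<^sup>2 \<le> (norm f)\<^sup>2"
    by (simp add: norm_diff_fproj[OF assms])
qed simp

lemma fproj_trig_space:
  assumes "p \<in> trig_space"
  shows "\<exists>G. finite G \<and> (\<forall>F. finite F \<longrightarrow> G \<subseteq> F \<longrightarrow> fproj F p = p)" (is "?P p")
  using assms unfolding trig_space_def
proof (induction rule: span_induct)
  case base
  interpret fproj: bounded_linear "fproj F" for F by (rule bounded_linear_fproj)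
  show ?case
  proof (rule subspaceI)
    show "0 \<in> {p. ?P p}"
      by (auto simp: fproj.zero)
  next
    fix p q assume "p \<in> {p. ?P p}" "q \<in> {p. ?P p}"
    then obtain G H where "finite G" "\<forall>F. finite F \<longrightarrow> G \<subseteq> F \<longrightarrow> fproj F p = p"
      "finite H" "\<forall>F. finite F \<longrightarrow> H \<subseteq> F \<longrightarrow> fproj F q = q" by blast
    then show "p + q \<in> {p. ?P p}"
      unfolding mem_Collect_eq by (intro exI[of _ "G \<union> H"]) (auto simp: fproj.add)
  next
    fix c p assume "p \<in> {p. ?P p}"
    then obtain G where "finite G" "\<forall>F. finite F \<longrightarrow> G \<subseteq> F \<longrightarrow> fproj F p = p" by blast
    then show "c *\<^sub>R p \<in> {p. ?P p}"
      unfolding mem_Collect_eq by (intro exI[of _ G]) (auto simp: fproj.scaleR)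
  qed
next
  case (step p)
  then obtain c k where p: "p = c *\<^sub>C fourier_mode k" by auto
  have "fproj F p = p" if "finite F" "k \<in> F" for F
    using that by (simp add: p fproj_def coef_scaleC coef_fourier_mode if_distrib[of "\<lambda>x. _ * x"]
      if_distrib[of "\<lambda>x. x *\<^sub>C _"] scaleC_zero cong: if_cong)
  then show ?case by (intro exI[of _ "{k}"]) auto
qed

lemma tendsto_fproj: "((\<lambda>F. fproj F f) \<longlongrightarrow> f) (finite_subsets_at_top UNIV)"
  unfolding tendsto_iff
proof (intro allI impI)
  fix e :: real assume e: "e > 0"
  have "f \<in> closure trig_space" by (simp add: closure_trig_space)
  then obtain p where p: "p \<in> trig_space" "dist p f < e"
    using e unfolding closure_approachable by blast
  then obtain G where G: "finite G" "\<And>F. finite F \<Longrightarrow> G \<subseteq> F \<Longrightarrow> fproj F p = p"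
    using fproj_trig_space by metis
  have "dist (fproj F f) f < e" if F: "finite F" "G \<subseteq> F" for F
  proof -
    \<comment> \<open>Once \<open>F\<close> contains all frequencies of \<open>p\<close>, the
      projection error of \<open>f\<close> is that of \<open>f - p\<close>, and taking the error
      does not increase norms.\<close>
    have "f - fproj F f = (f - p) - fproj F (f - p)"
      using G(2)[OF F] linear_diff[OF bounded_linear.linear[OF bounded_linear_fproj], of F f p]
          by simp
    then have "norm (f - fproj F f) \<le> norm (f - p)"
      using norm_diff_fproj_le[OF F(1), of "f - p"] by (simp only:)
    then show ?thesis using p(2) by (simp add: dist_norm norm_minus_commute)
  qed
  then show "\<forall>\<^sub>F F in finite_subsets_at_top UNIV. dist (fproj F f) f < e"
    using G(1) by (auto simp: eventually_finite_subsets_at_top)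
qed

lemma has_sum_fourier: "((\<lambda>k. coef f k *\<^sub>C fourier_mode k) has_sum f) UNIV"
  using tendsto_fproj[of f] by (simp add: has_sum_def fproj_def)

lemma has_sum_parseval: "((\<lambda>k. (cmod (coef f k))\<^sup>2) has_sum (norm f)\<^sup>2) UNIV"
proof -
  have "((\<lambda>F. (norm (fproj F f))\<^sup>2) \<longlongrightarrow> (norm f)\<^sup>2) (finite_subsets_at_top UNIV)"
    by (intro tendsto_intros tendsto_fproj)
  then show ?thesis
    unfolding has_sum_def
    by (rule Lim_transform_eventually)
       (auto simp: eventually_finite_subsets_at_top fproj_def norm_sum_modes)
qed

text \<open>A bounded functional may be applied to the series term by term. This later identifies
  the unnamed coefficients \<open>b\<close> in \<open>has_matrix\<close>.\<close>

lemma coef_unique: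
  assumes "((\<lambda>k. a k *\<^sub>C fourier_mode k) has_sum f) UNIV"
  shows "coef f j = a j"
proof -
  have "((\<lambda>k. coef (a k *\<^sub>C fourier_mode k) j) has_sum coef f j) UNIV"
    using has_sum_bounded_linear[OF bounded_linear_coef assms] by simp
  moreover have "((\<lambda>k. coef (a k *\<^sub>C fourier_mode k) j) has_sum a j) UNIV"
    by (rule has_sum_finite_neutralI[of "{j}"]) (auto simp: coef_scaleC coef_fourier_mode)
  ultimately show ?thesis by (rule has_sum_unique)
qed

text \<open>The sum is constructed as a concrete function: the Weierstrass M-test gives uniform
  convergence to a bounded continuous function, and on a space of mass 1 uniform convergence implies
  L2 convergence.\<close>

lemma l2_absolutely_summable:
  fixes a :: "int \<Rightarrow> complex"
  assumes a: "(\<lambda>k. cmod (a k)) summable_on UNIV"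
  shows "\<exists>f. ((\<lambda>k. a k *\<^sub>C fourier_mode k) has_sum f) UNIV"
proof -
  interpret finite_measure torus by (rule finite_measure_torus)
  let ?s = "\<lambda>F x. \<Sum>k\<in>F. a k * exp (\<i> * of_int k * complex_of_real x)"
  define f where "f x = (\<Sum>\<^sub>\<infinity>k. a k * exp (\<i> * of_int k * complex_of_real x))" for x
  have ul: "uniform_limit UNIV ?s f (finite_subsets_at_top UNIV)"
    unfolding f_def by (rule Weierstrass_m_test_general[OF _ a]) (simp add: norm_mult)
  have cf: "continuous_on UNIV f"
    by (rule uniform_limit_theorem[OF _ ul]) (auto intro!: always_eventually continuous_intros)
  have "cmod (f x) \<le> (\<Sum>\<^sub>\<infinity>k. cmod (a k))" for x
    unfolding f_def
    using norm_infsum_bound[of "\<lambda>k. a k * exp (\<i> * of_int k * complex_of_real x)" UNIV] a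
    by (simp add: norm_mult)
  then have sf: "square_integrable f"
    by (intro square_integrable_bounded borel_measurable_torus_continuous cf)
  have partial: "square_integrable (?s F)"
    "abs_l2_torus (?s F) = (\<Sum>k\<in>F. a k *\<^sub>C fourier_mode k)" if "finite F" for F
  proof -
    have "square_integrable (?s F) \<and> abs_l2_torus (?s F) = (\<Sum>k\<in>F. a k *\<^sub>C fourier_mode k)"
      using that
    proof (induction F)
      case (insert k F)
      let ?m = "\<lambda>x. a k * exp (\<i> * of_int k * complex_of_real x)"
      have m: "square_integrable ?m" by (intro square_integrable_cmult square_integrable_exp)
      have "abs_l2_torus (\<lambda>x. ?m x + ?s F x) = abs_l2_torus ?m + abs_l2_torus (?s F)"
        by (subst plus_l2_torus.abs_eq) (use m insert in \<open>simp_all add: l2_eq_refl\<close>)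
      also have "abs_l2_torus ?m = a k *\<^sub>C fourier_mode k"
        by (simp add: fourier_mode.abs_eq scaleC.abs_eq l2_eq_refl square_integrable_exp)
      finally show ?case
        using m insert by (simp add: square_integrable_add)
    qed (simp add: square_integrable_zero zero_l2_torus.abs_eq)
    then show "square_integrable (?s F)" "abs_l2_torus (?s F) = (\<Sum>k\<in>F. a k *\<^sub>C fourier_mode k)"
      by auto
  qed
  have "((\<lambda>F. \<Sum>k\<in>F. a k *\<^sub>C fourier_mode k) \<longlongrightarrow> abs_l2_torus f) (finite_subsets_at_top UNIV)"
    unfolding tendsto_iff
  proof (intro allI impI)
    fix e :: real assume e: "e > 0"
    have "\<forall>\<^sub>F F in finite_subsets_at_top UNIV. \<forall>x\<in>UNIV. dist (?s F x) (f x) < e / 2"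
      by (rule uniform_limitD[OF ul]) (use e in auto)
    moreover have "\<forall>\<^sub>F F in finite_subsets_at_top UNIV. finite (F::int set)"
      by (auto simp: eventually_finite_subsets_at_top)
    ultimately show "\<forall>\<^sub>F F in finite_subsets_at_top UNIV.
        dist (\<Sum>k\<in>F. a k *\<^sub>C fourier_mode k) (abs_l2_torus f) < e"
    proof eventually_elim
      case (elim F)
      note p = partial[OF elim(2)]
      have sq': "square_integrable (\<lambda>x. ?s F x - f x)"
        using square_integrable_add[OF p(1) square_integrable_cmult[where c = "-1", OF sf]] by simp
      have "(cmod (?s F x - f x))\<^sup>2 \<le> (e / 2)\<^sup>2" for x
        using elim(1) by (intro power_mono) (auto simp: dist_norm less_imp_le)
      then have "(LINT x|torus. (cmod (?s F x - f x))\<^sup>2) \<le> (LINT x|torus. (e / 2)\<^sup>2)"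
        using sq' by (intro integral_mono) (auto simp: square_integrable_def)
      also have "\<dots> = (e / 2)\<^sup>2"
        using emeasure_torus_space by (simp add: measure_def)
      finally have "norm (abs_l2_torus (?s F) - abs_l2_torus f) \<le> e / 2"
        unfolding norm_abs_diff[OF p(1) sf] using e by (intro real_le_lsqrt) auto
      then show ?case using e by (simp add: dist_norm p(2))
    qed
  qed
  then show ?thesis by (auto simp: has_sum_def)
qed

section \<open>Matrix rows and localisation\<close>

lemma restr_restr: "restr Y (restr Y f) = restr Y f"
  by transfer (auto simp: l2_eq_refl square_integrable_zero square_integrable_restrict mult.assoc[symmetric]
      simp flip: indicator_inter_arith)

lemma finite_int_subset_interval:
  assumes "finite (F :: int set)"
  obtains K where "K \<ge> 0" "F \<subseteq> {- K..K}"
proof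
  let ?K = "Max (insert 0 (abs ` F))"
  show "?K \<ge> 0" using assms by (intro Max_ge) auto
  have "\<bar>k\<bar> \<le> ?K" if "k \<in> F" for k using assms that by (intro Max_ge) auto
  then show "F \<subseteq> {- ?K..?K}" by (auto simp: abs_le_iff) (metis minus_le_iff)
qed

lemma norm_diff_fproj_antimono:
  assumes "finite G" "F \<subseteq> G"
  shows "norm (f - fproj G f) \<le> norm (f - fproj F f)"
proof (rule power2_le_imp_le)
  have "(\<Sum>k\<in>F. (cmod (coef f k))\<^sup>2) \<le> (\<Sum>k\<in>G. (cmod (coef f k))\<^sup>2)"
    using assms by (intro sum_mono2) auto
  then show "(norm (f - fproj G f))\<^sup>2 \<le> (norm (f - fproj F f))\<^sup>2"
    using assms finite_subset by (subst (1 2) norm_diff_fproj) auto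
qed simp

text \<open>By the Toeplitz property the coefficients for mode \<open>j\<close> are those for mode 0
  shifted by \<open>j\<close>, so a \<open>D\<close> chosen for mode 0 serves all modes.\<close>

lemma restr_mode_truncation:
  assumes "\<delta> > 0" "Y \<in> sets torus"
  obtains D where "D \<ge> 0"
    "\<And>j. norm (restr Y (fourier_mode j) - fproj {j - D..j + D} (restr Y (fourier_mode j))) \<le> \<delta>"
proof -
  let ?u = "\<lambda>j. restr Y (fourier_mode j)"
  have "\<forall>\<^sub>F F in finite_subsets_at_top UNIV. dist (fproj F (?u 0)) (?u 0) < \<delta>"
    using tendsto_fproj[of "?u 0"] assms(1) unfolding tendsto_iff by blast
  then obtain F where F: "finite F" "dist (fproj F (?u 0)) (?u 0) < \<delta>"
    by (auto simp: eventually_finite_subsets_at_top)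
  obtain D where D: "D \<ge> 0" "F \<subseteq> {- D..D}"
    using finite_int_subset_interval[OF F(1)] .
  have "norm (?u 0 - fproj {- D..D} (?u 0)) \<le> \<delta>"
    using norm_diff_fproj_antimono[OF _ D(2), of "?u 0"] F(2)
    by (simp add: dist_norm norm_minus_commute)
  moreover have "norm (?u j - fproj {j - D..j + D} (?u j))
      = norm (?u 0 - fproj {- D..D} (?u 0))" for j
  proof -
    have "(\<Sum>k\<in>{j - D..j + D}. (cmod (coef (?u j) k))\<^sup>2) = (\<Sum>k\<in>{- D..D}. (cmod (coef (?u 0) k))\<^sup>2)"
      by (rule sum.reindex_bij_witness[where i = "\<lambda>k. k + j" and j = "\<lambda>k. k - j"])
         (auto simp: coef_restr_fourier_mode[of Y j])
    then have "(norm (?u j - fproj {j - D..j + D} (?u j)))\<^sup>2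
        = (norm (?u 0 - fproj {- D..D} (?u 0)))\<^sup>2"
      by (simp add: norm_diff_fproj norm_restr_fourier_mode[OF assms(2)])
    then show ?thesis by (simp add: power2_eq_iff_nonneg)
  qed
  ultimately show thesis using D(1) that by metis
qed

lemma fproj_scaleC: "fproj F (c *\<^sub>C f) = c *\<^sub>C fproj F f"
  using linear_sum[OF bounded_linear.linear[OF bounded_linear_scaleC],
      of c "\<lambda>k. coef f k *\<^sub>C fourier_mode k" F]
  by (simp add: fproj_def coef_scaleC scaleC_scaleC)

section \<open>Boundedness of operators of diagonal type\<close>

context
  fixes W :: "l2_torus \<Rightarrow> l2_torus" and M :: "int \<Rightarrow> int \<Rightarrow> complex"
  assumes W: "diagonal_type W M"
begin

lemma cmod_le_diag_sup: "cmod (M l j) \<le> diag_sup M (l - j)"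
proof -
  have bdd: "bdd_above (range (\<lambda>j. cmod (M (k + j) j)))" for k
    using W by (simp add: diagonal_type_def)
  show ?thesis
    using cSUP_upper[OF UNIV_I bdd[of "l - j"], of j] by (simp add: diag_sup_def)
qed

lemma diag_sup_nonneg: "0 \<le> diag_sup M k"
  using cmod_le_diag_sup[of k 0] norm_ge_zero[of "M k 0"] by (simp del: norm_ge_zero)

lemma has_sum_diag_sup: "(diag_sup M has_sum infsum (diag_sup M) UNIV) UNIV"
  using W by (simp add: diagonal_type_def)

lemma has_sum_diag_sup_row: "((\<lambda>j. diag_sup M (l - j)) has_sum infsum (diag_sup M) UNIV) UNIV"
proof -
  have "bij (\<lambda>j::int. l - j)"
    by (rule bij_betw_byWitness[where f' = "\<lambda>j. l - j"]) auto
  from has_sum_reindex_bij_betw[OF this, of "diag_sup M"] show ?thesis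
    using has_sum_diag_sup by simp
qed

lemma sum_diag_sup_row_le: "finite F \<Longrightarrow> (\<Sum>j\<in>F. diag_sup M (l - j)) \<le> infsum (diag_sup M) UNIV"
  by (rule finite_sum_le_has_sum[OF has_sum_diag_sup_row]) (auto simp: diag_sup_nonneg)

lemma sum_diag_sup_column_le: "finite F \<Longrightarrow> (\<Sum>l\<in>F. diag_sup M (l - j)) \<le> infsum (diag_sup M) UNIV"
proof -
  assume F: "finite F"
  have "(\<Sum>l\<in>F. diag_sup M (l - j)) = sum (diag_sup M) ((\<lambda>l. l - j) ` F)"
    by (subst sum.reindex) (auto simp: inj_on_def)
  also have "\<dots> \<le> infsum (diag_sup M) UNIV"
    by (rule finite_sum_le_has_sum[OF has_sum_diag_sup]) (use F in \<open>auto simp: diag_sup_nonneg\<close>)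
  finally show ?thesis .
qed

lemma infsum_diag_sup_nonneg: "0 \<le> infsum (diag_sup M) UNIV"
  by (intro infsum_nonneg) (auto simp: diag_sup_nonneg)

text \<open>The Fourier expansion makes \<open>has_matrix\<close> applicable to every
  \<open>f\<close> with its own coefficients.\<close>

lemma has_sum_coef_W: "((\<lambda>k. M l k * coef f k) has_sum coef (W f) l) UNIV"
proof -
  have "has_matrix W M" using W by (simp add: diagonal_type_def)
  then obtain b where "\<forall>j. ((\<lambda>k. M j k * coef f k) has_sum b j) UNIV"
     "((\<lambda>j. b j *\<^sub>C fourier_mode j) has_sum W f) UNIV"
    using has_sum_fourier[of f] unfolding has_matrix_def by blast
  then show ?thesis using coef_unique by metis
qed

text \<open>Cauchy-Schwarz with the weight split as \<open>sqrt c * (sqrt c * |a|)\<close>. One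
  factor of the constant comes from the row sums of \<open>diag_sup M (l - j)\<close>, the other
  from its column sums.\<close>

lemma schur_test:
  assumes "finite G" "finite F"
  shows "(\<Sum>l\<in>G. (cmod (\<Sum>j\<in>F. M l j * a j))\<^sup>2) \<le> (infsum (diag_sup M) UNIV)\<^sup>2 * (\<Sum>j\<in>F. (cmod (a j))\<^sup>2)"
proof -
  let ?C = "infsum (diag_sup M) UNIV" and ?c = "\<lambda>l j. diag_sup M (l - j)"
  have row_bound: "(cmod (\<Sum>j\<in>F. M l j * a j))\<^sup>2 \<le> ?C * (\<Sum>j\<in>F. ?c l j * (cmod (a j))\<^sup>2)" for l
  proof -
    have "cmod (\<Sum>j\<in>F. M l j * a j) \<le> (\<Sum>j\<in>F. ?c l j * cmod (a j))"
      by (intro sum_norm_le) (auto simp: norm_mult intro: mult_right_mono cmod_le_diag_sup)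
    also have "\<dots> = (\<Sum>j\<in>F. sqrt (?c l j) * (sqrt (?c l j) * cmod (a j)))"
      by (simp add: mult.assoc[symmetric] diag_sup_nonneg)
    finally have "(cmod (\<Sum>j\<in>F. M l j * a j))\<^sup>2 \<le> (\<Sum>j\<in>F. sqrt (?c l j) * (sqrt (?c l j) * cmod (a j)))\<^sup>2"
      by (intro power_mono) auto
    also have "\<dots> \<le> (\<Sum>j\<in>F. (sqrt (?c l j))\<^sup>2) * (\<Sum>j\<in>F. (sqrt (?c l j) * cmod (a j))\<^sup>2)"
      by (rule Cauchy_Schwarz_ineq_sum)
    also have "\<dots> = (\<Sum>j\<in>F. ?c l j) * (\<Sum>j\<in>F. ?c l j * (cmod (a j))\<^sup>2)"
      by (simp add: power_mult_distrib diag_sup_nonneg)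
    also have "\<dots> \<le> ?C * (\<Sum>j\<in>F. ?c l j * (cmod (a j))\<^sup>2)"
      using assms by (intro mult_right_mono sum_diag_sup_row_le sum_nonneg)
          (auto simp: diag_sup_nonneg)
    finally show ?thesis .
  qed
  have "(\<Sum>l\<in>G. (cmod (\<Sum>j\<in>F. M l j * a j))\<^sup>2) \<le> (\<Sum>l\<in>G. ?C * (\<Sum>j\<in>F. ?c l j * (cmod (a j))\<^sup>2))"
    by (intro sum_mono row_bound)
  also have "\<dots> = ?C * (\<Sum>l\<in>G. \<Sum>j\<in>F. ?c l j * (cmod (a j))\<^sup>2)"
    by (simp only: sum_distrib_left)
  also have "(\<Sum>l\<in>G. \<Sum>j\<in>F. ?c l j * (cmod (a j))\<^sup>2) = (\<Sum>j\<in>F. (\<Sum>l\<in>G. ?c l j) * (cmod (a j))\<^sup>2)"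
    by (subst sum.swap) (simp only: sum_distrib_right)
  also have "?C * (\<Sum>j\<in>F. (\<Sum>l\<in>G. ?c l j) * (cmod (a j))\<^sup>2) \<le> ?C * (\<Sum>j\<in>F. ?C * (cmod (a j))\<^sup>2)"
    using assms by (intro mult_left_mono sum_mono mult_right_mono sum_diag_sup_column_le)
      (auto simp: infsum_diag_sup_nonneg)
  also have "\<dots> = ?C\<^sup>2 * (\<Sum>j\<in>F. (cmod (a j))\<^sup>2)"
    by (simp add: sum_distrib_left power2_eq_square mult.assoc)
  finally show ?thesis .
qed

lemma norm_W_le: "norm (W f) \<le> infsum (diag_sup M) UNIV * norm f"
proof (rule power2_le_imp_le)
  let ?C = "infsum (diag_sup M) UNIV"
  have "(\<Sum>l\<in>G. (cmod (coef (W f) l))\<^sup>2) \<le> ?C\<^sup>2 * (norm f)\<^sup>2" if G: "finite G" for G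
  \<comment> \<open>The output frequencies \<open>G\<close> stay fixed while the input set
    \<open>F\<close> exhausts the integers; afterwards Parseval lets \<open>G\<close> grow.\<close>
  proof (rule tendsto_upperbound)
    show "((\<lambda>F. \<Sum>l\<in>G. (cmod (\<Sum>j\<in>F. M l j * coef f j))\<^sup>2) \<longlongrightarrow> (\<Sum>l\<in>G. (cmod (coef (W f) l))\<^sup>2))
       (finite_subsets_at_top UNIV)"
      using has_sum_coef_W unfolding has_sum_def by (intro tendsto_intros)
    have "(\<Sum>l\<in>G. (cmod (\<Sum>j\<in>F. M l j * coef f j))\<^sup>2) \<le> ?C\<^sup>2 * (norm f)\<^sup>2" if F: "finite F" for F
    proof -
      have "(\<Sum>j\<in>F. (cmod (coef f j))\<^sup>2) \<le> (norm f)\<^sup>2"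
        by (rule finite_sum_le_has_sum[OF has_sum_parseval]) (use F in auto)
      then show ?thesis
        by (intro order.trans[OF schur_test[OF G F]] mult_left_mono) auto
    qed
    then show "\<forall>\<^sub>F F in finite_subsets_at_top UNIV. (\<Sum>l\<in>G. (cmod (\<Sum>j\<in>F. M l j * coef f j))\<^sup>2)
        \<le> ?C\<^sup>2 * (norm f)\<^sup>2"
      by (auto simp: eventually_finite_subsets_at_top)
  qed simp
  then show "(norm (W f))\<^sup>2 \<le> (?C * norm f)\<^sup>2"
    by (intro has_sum_le_finite_sums[OF has_sum_parseval]) (simp add: power_mult_distrib)
qed (simp add: infsum_diag_sup_nonneg)

text \<open>Since \<open>restr Y\<close> is idempotent, the operator norm can be tested on
  \<open>restr Y f\<close> itself. This gains the factor \<open>norm (restr Y f)\<close> in place of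
  \<open>norm f\<close>.\<close>

lemma norm_W_restr_le: "norm (W (restr Y f)) \<le> onorm (W \<circ> restr Y) * norm (restr Y f)"
proof (cases "restr Y f = 0")
  case True
  then show ?thesis using norm_W_le[of 0] by simp
next
  case False
  let ?C = "infsum (diag_sup M) UNIV"
  \<comment> \<open>\<open>onorm\<close> is a real supremum, so it dominates its quotients only once
    they are known to be bounded.\<close>
  have "bdd_above (range (\<lambda>g. norm ((W \<circ> restr Y) g) / norm g))"
  proof (rule bdd_aboveI2)
    fix g
    have "norm (W (restr Y g)) \<le> ?C * norm g"
      by (rule order.trans[OF norm_W_le]) (intro mult_left_mono norm_restr_le infsum_diag_sup_nonneg)
    then show "norm ((W \<circ> restr Y) g) / norm g \<le> ?C"
      by (cases "g = 0") (auto simp: divide_le_eq infsum_diag_sup_nonneg)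
  qed
  then have "norm ((W \<circ> restr Y) (restr Y f)) / norm (restr Y f) \<le> onorm (W \<circ> restr Y)"
    unfolding onorm_def by (rule cSUP_upper[OF UNIV_I])
  with False show ?thesis by (simp add: restr_restr divide_le_eq)
qed

lemma sum_norm_W_restr_le:
  assumes "torus_partition J Y"
  shows "(\<Sum>i<J. (norm (W (restr (Y i) (fourier_mode k))))\<^sup>2) \<le> partition_sum J Y W"
  unfolding partition_sum_def
proof (rule sum_mono)
  fix i assume "i \<in> {..<J}"
  then have Y: "Y i \<in> sets torus" using assms by (auto simp: torus_partition_def)
  have "(norm (W (restr (Y i) (fourier_mode k))))\<^sup>2
      \<le> (onorm (W \<circ> restr (Y i)) * norm (restr (Y i) (fourier_mode k)))\<^sup>2"
    by (intro power_mono norm_W_restr_le) auto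
  then show "(norm (W (restr (Y i) (fourier_mode k))))\<^sup>2
      \<le> measure torus (Y i) * (onorm (W \<circ> restr (Y i)))\<^sup>2"
    by (simp add: power_mult_distrib norm_restr_fourier_mode[OF Y] mult.commute)
qed

section \<open>Row functions and their localisation\<close>

definition row_function :: "int \<Rightarrow> l2_torus" where
  "row_function l = (SOME f. ((\<lambda>j. cnj (M l j) *\<^sub>C fourier_mode j) has_sum f) UNIV)"

text \<open>Each row is dominated by the reflected and shifted sequence \<open>diag_sup M\<close>,
  hence absolutely summable, so the choice in \<open>row_function\<close> has a witness.\<close>

lemma has_sum_row: "((\<lambda>j. cnj (M l j) *\<^sub>C fourier_mode j) has_sum row_function l) UNIV"
proof -
  have "(\<lambda>j. diag_sup M (l - j)) summable_on UNIV"
    using has_sum_diag_sup_row by (rule has_sum_imp_summable)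
  then have "(\<lambda>j. cmod (cnj (M l j))) summable_on UNIV"
    by (rule summable_on_comparison_test) (auto simp: cmod_le_diag_sup)
  from l2_absolutely_summable[OF this] show ?thesis
    unfolding row_function_def by (rule someI_ex)
qed

lemma coef_row: "coef (row_function l) j = cnj (M l j)"
  using coef_unique[OF has_sum_row] .

lemma has_sum_norm_row: "((\<lambda>j. (cmod (M l j))\<^sup>2) has_sum (norm (row_function l))\<^sup>2) UNIV"
  using has_sum_parseval[of "row_function l"] by (simp add: coef_row)

text \<open>The adjoint relation. Expanding the row series on one side and the matrix action on the
  other gives the same series, by the Hermitian symmetry of \<open>restr Y\<close>.\<close>

lemma coef_restr_row: "coef (restr Y (row_function l)) k
    = cnj (coef (W (restr Y (fourier_mode k))) l)"
proof -
  have "((\<lambda>j. coef (restr Y (cnj (M l j) *\<^sub>C fourier_mode j)) k)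
      has_sum coef (restr Y (row_function l)) k) UNIV"
    by (rule has_sum_bounded_linear[OF bounded_linear_compose[OF bounded_linear_coef bounded_linear_restr] has_sum_row])
  moreover have "coef (restr Y (cnj (M l j) *\<^sub>C fourier_mode j)) k
      = cnj (M l j * coef (restr Y (fourier_mode k)) j)" for j
    using coef_restr_fourier_mode_swap[of Y j k] by (simp add: restr_scaleC coef_scaleC)
  ultimately have "((\<lambda>j. cnj (M l j * coef (restr Y (fourier_mode k)) j))
      has_sum coef (restr Y (row_function l)) k) UNIV"
    by simp
  moreover have "((\<lambda>j. cnj (M l j * coef (restr Y (fourier_mode k)) j)) has_sum
      cnj (coef (W (restr Y (fourier_mode k))) l)) UNIV"
    using has_sum_coef_W by (simp only: has_sum_cnj_iff)
  ultimately show ?thesis by (rule has_sum_unique)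
qed

text \<open>Entries satisfy \<open>|M l j| <= diag_sup M (l - j)\<close>, and the squares of
  \<open>diag_sup M\<close> are summable because each is at most the total sum times
  \<open>diag_sup M k\<close>. Its tail bounds all row tails at once.\<close>

lemma row_truncation:
  assumes "\<delta> > 0"
  obtains K where "K \<ge> 0" "\<And>l. norm (row_function l - fproj {l - K..l + K} (row_function l)) \<le> \<delta>"
proof -
  let ?c2 = "\<lambda>k. (diag_sup M k)\<^sup>2"
  let ?C = "infsum (diag_sup M) UNIV"
  have "diag_sup M k \<le> ?C" for k
    using sum_diag_sup_column_le[of "{k}" 0] by simp
  then have le: "?c2 k \<le> ?C * diag_sup M k" for k
    unfolding power2_eq_square by (intro mult_right_mono) (auto simp: diag_sup_nonneg)
  have "(\<lambda>k. ?C * diag_sup M k) summable_on UNIV"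
    using has_sum_imp_summable[OF has_sum_diag_sup] by (rule summable_on_cmult_right)
  then have "?c2 summable_on UNIV"
    by (rule summable_on_comparison_test[OF _ le zero_le_power2])
  then have hs: "(?c2 has_sum infsum ?c2 UNIV) UNIV" by simp
  let ?S = "infsum ?c2 UNIV"
  obtain F where F: "finite F" "dist (sum ?c2 F) ?S \<le> \<delta>\<^sup>2"
    using has_sum_finite_approximation[OF hs, of "\<delta>\<^sup>2"] assms by auto
  obtain K where K: "K \<ge> 0" "F \<subseteq> {- K..K}"
    using finite_int_subset_interval[OF F(1)] .
  have "?S - sum ?c2 {- K..K} \<le> ?S - sum ?c2 F"
    using K F by (intro diff_left_mono sum_mono2) auto
  also have "\<dots> \<le> \<delta>\<^sup>2" using F(2) by (simp add: dist_real_def)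
  finally have tail: "?S - sum ?c2 {- K..K} \<le> \<delta>\<^sup>2" .
  have "norm (row_function l - fproj {l - K..l + K} (row_function l)) \<le> \<delta>" for l
  proof (rule power2_le_imp_le)
    have "bij (\<lambda>j::int. l - j)"
      by (rule bij_betw_byWitness[where f' = "\<lambda>j. l - j"]) auto
    from has_sum_reindex_bij_betw[OF this, of ?c2] have "((\<lambda>j. ?c2 (l - j)) has_sum ?S) UNIV"
      using hs by simp
    \<comment> \<open>The terms are nonnegative, so the part inside the window is at most the whole;
      rearranged, the tail of row \<open>l\<close> is at most the tail of
      \<open>?c2\<close>.\<close>
    then have "((\<lambda>j. ?c2 (l - j) - (cmod (M l j))\<^sup>2) has_sum (?S - (norm (row_function l))\<^sup>2)) UNIV"
      using has_sum_add[OF _ has_sum_uminusI[OF has_sum_norm_row[of l]]] by fastforce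
    then have "(\<Sum>j\<in>{l - K..l + K}. ?c2 (l - j) - (cmod (M l j))\<^sup>2) \<le> ?S - (norm (row_function l))\<^sup>2"
      by (rule finite_sum_le_has_sum) (auto intro: power_mono cmod_le_diag_sup)
    moreover have "(\<Sum>j\<in>{l - K..l + K}. ?c2 (l - j)) = sum ?c2 {- K..K}"
      by (rule sum.reindex_bij_witness[where i = "\<lambda>k. l - k" and j = "\<lambda>j. l - j"]) auto
    ultimately show "(norm (row_function l - fproj {l - K..l + K} (row_function l)))\<^sup>2 \<le> \<delta>\<^sup>2"
      using tail by (simp add: norm_diff_fproj coef_row sum_subtractf)
  qed (use assms in simp)
  with K show thesis using that by blast
qed


text \<open>The row is split into finitely many nearby modes and a small remainder. Each restricted
  mode is concentrated near its own frequency, and the row coefficients are bounded in sum, so the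
  errors add up uniformly in \<open>l\<close>.\<close>

lemma restr_row_truncation:
  assumes Y: "Y \<in> sets torus" and e: "e > 0"
  shows "\<forall>\<^sub>F L in at_top. \<forall>l. (norm (restr Y (row_function l)))\<^sup>2
     \<le> e + (\<Sum>k\<in>{l - L..l + L}. (cmod (coef (restr Y (row_function l)) k))\<^sup>2)"
proof -
  let ?C = "infsum (diag_sup M) UNIV" and ?R = row_function
  have C: "?C \<ge> 0" by (rule infsum_diag_sup_nonneg)
  \<comment> \<open>The remainder costs \<open>\<delta>\<close> and the nearby modes at most
    \<open>?C * \<delta>\<close>; together this is \<open>sqrt e\<close>.\<close>
  define \<delta> where "\<delta> = sqrt e / (1 + ?C)"
  have \<delta>: "\<delta> > 0" "(1 + ?C) * \<delta> = sqrt e" using e C by (auto simp: \<delta>_def field_simps)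
  obtain K where K: "K \<ge> 0" "\<And>l. norm (?R l - fproj {l - K..l + K} (?R l)) \<le> \<delta>"
    using row_truncation[OF \<delta>(1)] by blast
  obtain D where D: "D \<ge> 0" "\<And>j. norm (restr Y (fourier_mode j)
      - fproj {j - D..j + D} (restr Y (fourier_mode j))) \<le> \<delta>"
    using restr_mode_truncation[OF \<delta>(1) Y] by blast
  \<comment> \<open>Modes within \<open>K\<close> of \<open>l\<close>, each spread over radius
    \<open>D\<close>, fit into the window of radius \<open>K + D\<close>.\<close>
  have "(norm (restr Y (?R l)))\<^sup>2 \<le> e + (\<Sum>k\<in>{l - L..l + L}. (cmod (coef (restr Y (?R l)) k))\<^sup>2)"
    if L: "L \<ge> K + D" for L l
  proof -
    define T where "T f = restr Y f - fproj {l - L..l + L} (restr Y f)" for f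
    have lin: "bounded_linear T"
      unfolding T_def
      by (intro bounded_linear_sub bounded_linear_restr bounded_linear_compose[OF bounded_linear_fproj bounded_linear_restr])
    interpret T: bounded_linear T by (rule lin)
    have TscaleC: "T (c *\<^sub>C f) = c *\<^sub>C T f" for c f
      unfolding T_def restr_scaleC fproj_scaleC
      by (rule linear_diff[OF bounded_linear.linear[OF bounded_linear_scaleC], symmetric])
    have Tle: "norm (T f) \<le> norm f" for f
      unfolding T_def by (intro order.trans[OF norm_diff_fproj_le] norm_restr_le) simp
    have Tmode: "norm (T (fourier_mode j)) \<le> \<delta>" if "j \<in> {l - K..l + K}" for j
      unfolding T_def using that L
      by (intro order.trans[OF norm_diff_fproj_antimono D(2)[of j]]) auto
    have "norm (T (fproj {l - K..l + K} (?R l))) \<le> (\<Sum>j\<in>{l - K..l + K}. cmod (M l j) * \<delta>)"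
      unfolding fproj_def T.sum
      by (intro sum_norm_le) (auto simp: TscaleC norm_scaleC coef_row intro!: mult_left_mono Tmode)
    also have "\<dots> \<le> ?C * \<delta>"
    proof -
      have "(\<Sum>j\<in>{l - K..l + K}. cmod (M l j)) \<le> (\<Sum>j\<in>{l - K..l + K}. diag_sup M (l - j))"
        by (intro sum_mono cmod_le_diag_sup)
      also have "\<dots> \<le> ?C" by (intro sum_diag_sup_row_le) simp
      finally show ?thesis
        using \<delta>(1) by (simp flip: sum_distrib_right)
    qed
    finally have "norm (T (fproj {l - K..l + K} (?R l))) \<le> ?C * \<delta>" .
    moreover have "norm (T (?R l - fproj {l - K..l + K} (?R l))) \<le> \<delta>"
      using Tle K(2) order.trans by blast
    moreover have "T (?R l) = T (?R l - fproj {l - K..l + K} (?R l)) + T (fproj {l - K..l + K} (?R l))"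
      by (simp flip: T.add)
    ultimately have "norm (T (?R l)) \<le> (1 + ?C) * \<delta>"
      using norm_triangle_ineq[of "T (?R l - fproj {l - K..l + K} (?R l))" "T (fproj {l - K..l + K} (?R l))"]
      by (simp add: distrib_right)
    then have "(norm (T (?R l)))\<^sup>2 \<le> (sqrt e)\<^sup>2"
      unfolding \<delta>(2) by (intro power_mono) auto
    then show ?thesis
      unfolding T_def using e by (simp add: norm_diff_fproj)
  qed
  then show ?thesis by (auto simp: eventually_at_top_linorder)
qed

text \<open>Localisation costs \<open>e\<close> for each pair of a row and a partition set; the last
  term pays for the boundary of the enlarged interval. It is essential that \<open>L\<close> does
  not depend on \<open>n\<close> and \<open>m\<close>.\<close>

lemma sum_norm_row_le:
  assumes P: "torus_partition J Y" and e: "e > 0"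
  obtains L where "L \<ge> 0" "\<And>n m. n \<le> m \<Longrightarrow> (\<Sum>l\<in>{n..m}. (norm (row_function l))\<^sup>2)
     \<le> real (card {n..m}) * (real J * e + partition_sum J Y W) + 2 * real_of_int L * partition_sum J Y W"
proof -
  let ?S = "partition_sum J Y W" and ?R = row_function
  have "\<forall>\<^sub>F L in at_top. \<forall>i\<in>{..<J}. \<forall>l. (norm (restr (Y i) (?R l)))\<^sup>2
     \<le> e + (\<Sum>k\<in>{l - L..l + L}. (cmod (coef (restr (Y i) (?R l)) k))\<^sup>2)"
    using P e by (intro eventually_ball_finite ballI restr_row_truncation)
        (auto simp: torus_partition_def)
  then have "\<forall>\<^sub>F L in at_top. L \<ge> 0 \<and> (\<forall>i\<in>{..<J}. \<forall>l. (norm (restr (Y i) (?R l)))\<^sup>2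
     \<le> e + (\<Sum>k\<in>{l - L..l + L}. (cmod (coef (restr (Y i) (?R l)) k))\<^sup>2))"
    by (intro eventually_conj eventually_ge_at_top)
  then obtain L where L: "L \<ge> (0::int)" and tail: "\<And>i l. i < J \<Longrightarrow> (norm (restr (Y i) (?R l)))\<^sup>2
     \<le> e + (\<Sum>k\<in>{l - L..l + L}. (cmod (coef (restr (Y i) (?R l)) k))\<^sup>2)"
    by (auto dest!: eventually_happens)
  have "(\<Sum>l\<in>{n..m}. (norm (?R l))\<^sup>2)
     \<le> real (card {n..m}) * (real J * e + ?S) + 2 * real_of_int L * ?S" if nm: "n \<le> m" for n m
  proof -
    let ?w = "\<lambda>i k l. (cmod (coef (W (restr (Y i) (fourier_mode k))) l))\<^sup>2"
    have "(\<Sum>l\<in>{n..m}. (norm (?R l))\<^sup>2) \<le> (\<Sum>l\<in>{n..m}. \<Sum>i<J. (norm (restr (Y i) (?R l)))\<^sup>2)"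
      by (intro sum_mono norm_le_sum_restr[OF P])
    also have "\<dots> \<le> (\<Sum>l\<in>{n..m}. \<Sum>i<J. e + (\<Sum>k\<in>{n - L..m + L}. ?w i k l))"
    proof (intro sum_mono)
      fix l i assume "l \<in> {n..m}" "i \<in> {..<J}"
      then have "(\<Sum>k\<in>{l - L..l + L}. ?w i k l) \<le> (\<Sum>k\<in>{n - L..m + L}. ?w i k l)"
        by (intro sum_mono2) auto
      with tail[of i l] \<open>i \<in> {..<J}\<close>
      show "(norm (restr (Y i) (?R l)))\<^sup>2 \<le> e + (\<Sum>k\<in>{n - L..m + L}. ?w i k l)"
        by (simp add: coef_restr_row)
    qed
    also have "\<dots> = real (card {n..m}) * (real J * e) + (\<Sum>l\<in>{n..m}. \<Sum>i<J. \<Sum>k\<in>{n - L..m + L}. ?w i k l)"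
      by (simp add: sum.distrib)
    \<comment> \<open>With \<open>k\<close> outermost, the inner sum over \<open>l\<close> is a
      partial Parseval sum for the image of one restricted mode.\<close>
    also have "(\<Sum>l\<in>{n..m}. \<Sum>i<J. \<Sum>k\<in>{n - L..m + L}. ?w i k l)
       = (\<Sum>k\<in>{n - L..m + L}. \<Sum>i<J. \<Sum>l\<in>{n..m}. ?w i k l)"
      by (subst sum.swap, subst (2) sum.swap, subst sum.swap) (rule refl)
    also have "\<dots> \<le> (\<Sum>k\<in>{n - L..m + L}. \<Sum>i<J. (norm (W (restr (Y i) (fourier_mode k))))\<^sup>2)"
      by (intro sum_mono finite_sum_le_has_sum[OF has_sum_parseval]) auto
    also have "\<dots> \<le> (\<Sum>k\<in>{n - L..m + L}. ?S)"
      by (intro sum_mono sum_norm_W_restr_le[OF P])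
    \<comment> \<open>Enlarging the interval by \<open>L\<close> at each end adds exactly
      \<open>2 * L\<close> frequencies.\<close>
    also have "\<dots> = (real (card {n..m}) + 2 * real_of_int L) * ?S"
      using nm L by (simp add: of_nat_nat)
    finally show ?thesis by (simp add: algebra_simps)
  qed
  with L that show thesis by blast
qed

section \<open>From row norms to the limsup of averages\<close>

lemma row_average_le:
  assumes "n \<le> m"
  shows "row_average M {n..m} \<le> ennreal ((\<Sum>l\<in>{n..m}. (norm (row_function l))\<^sup>2) / real (card {n..m}))"
proof -
  let ?f = "\<lambda>(j, l). (cmod (M l j))\<^sup>2"
  have "sum ?f F \<le> (\<Sum>l\<in>{n..m}. (norm (row_function l))\<^sup>2)"
      if F: "finite F" "F \<subseteq> UNIV \<times> {n..m}" for F
  proof -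
    \<comment> \<open>A finite index set is enclosed in a finite rectangle, on which the sum splits
      into rows and Parseval bounds each row.\<close>
    have "F \<subseteq> fst ` F \<times> {n..m}" using F by force
    then have "sum ?f F \<le> sum ?f (fst ` F \<times> {n..m})"
      using F by (intro sum_mono2) auto
    also have "\<dots> = (\<Sum>l\<in>{n..m}. \<Sum>j\<in>fst ` F. (cmod (M l j))\<^sup>2)"
      by (subst sum.swap) (simp add: sum.cartesian_product)
    also have "\<dots> \<le> (\<Sum>l\<in>{n..m}. (norm (row_function l))\<^sup>2)"
      using F by (intro sum_mono finite_sum_le_has_sum[OF has_sum_norm_row]) auto
    finally show ?thesis .
  qed
  then have "(\<Sum>(j, l)\<in>F. ennreal ((cmod (M l j))\<^sup>2))
      \<le> ennreal (\<Sum>l\<in>{n..m}. (norm (row_function l))\<^sup>2)"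
    if "finite F" "F \<subseteq> UNIV \<times> {n..m}" for F
    using that by (subst case_prod_unfold, subst sum_ennreal)
        (auto intro!: ennreal_leI simp: case_prod_unfold)
  then have "(\<Sum>\<^sub>\<infinity>(j, l)\<in>UNIV \<times> {n..m}. ennreal ((cmod (M l j))\<^sup>2))
      \<le> ennreal (\<Sum>l\<in>{n..m}. (norm (row_function l))\<^sup>2)"
    by (subst nonneg_infsum_complete) (auto intro!: SUP_least)
  then have "row_average M {n..m} \<le> ennreal (\<Sum>l\<in>{n..m}. (norm (row_function l))\<^sup>2) / of_nat (card {n..m})"
    unfolding row_average_def by (rule divide_right_mono_ennreal)
  also have "\<dots> = ennreal ((\<Sum>l\<in>{n..m}. (norm (row_function l))\<^sup>2) / real (card {n..m}))"
    using assms by (subst divide_ennreal[symmetric])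
        (auto intro: sum_nonneg simp: ennreal_of_nat_eq_real_of_nat)
  finally show ?thesis .
qed

lemma limsup_row_average_le:
  assumes P: "torus_partition J Y"
  shows "limsup_row_average M \<le> ennreal (partition_sum J Y W)"
proof (rule ennreal_le_epsilon)
  fix e :: real assume e: "e > 0"
  let ?S = "partition_sum J Y W"
  have S: "?S \<ge> 0" by (auto simp: partition_sum_def intro!: sum_nonneg)
  define X where "X N = (SUP I\<in>{I. (\<exists>n m. n \<le> m \<and> I = {n..m}) \<and> card I \<ge> N}. row_average M I)" for N
  \<comment> \<open>The limit is thereby an infimum, so bounding a single \<open>X N\<close>
    suffices.\<close>
  have "decseq X"
    unfolding X_def by (intro decseq_SucI SUP_subset_mono) auto
  then have "X \<longlonglongrightarrow> (INF N. X N)" by (rule LIMSEQ_INF)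
  then have lim: "limsup_row_average M = (INF N. X N)"
    unfolding limsup_row_average_def X_def[symmetric] by (rule limI)
  \<comment> \<open>The error budget \<open>e\<close> is halved: one half for the \<open>J\<close>
    localisation errors, one for the boundary. The \<open>+ 1\<close> keeps the denominator positive
    for every \<open>J\<close>.\<close>
  define d where "d = e / (2 * (real J + 1))"
  have "d > 0" and d: "real J * d \<le> e / 2" using e by (auto simp: d_def field_simps)
  obtain L where L: "L \<ge> 0" and bound: "\<And>n m. n \<le> m \<Longrightarrow> (\<Sum>l\<in>{n..m}. (norm (row_function l))\<^sup>2)
     \<le> real (card {n..m}) * (real J * d + ?S) + 2 * real_of_int L * ?S"
    using sum_norm_row_le[OF P \<open>d > 0\<close>] by blast
  \<comment> \<open>Intervals longer than \<open>N\<close> absorb the fixed boundary term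
    \<open>2 * L * ?S\<close> into the other half of the budget.\<close>
  obtain N where N: "2 * real_of_int L * ?S / (e / 2) < real N" using reals_Archimedean2 by blast
  have "X (Suc N) \<le> ennreal (?S + e)"
    unfolding X_def
  proof (rule SUP_least, clarify)
    fix n m :: int assume nm: "n \<le> m" and c: "Suc N \<le> card {n..m}"
    let ?c = "real (card {n..m})"
    have c0: "?c > 0" using c by linarith
    have "2 * real_of_int L * ?S < real N * (e / 2)" using N e by (simp add: field_simps)
    also have "\<dots> \<le> ?c * (e / 2)" using c e by (intro mult_right_mono) auto
    finally have "2 * real_of_int L * ?S \<le> ?c * (e / 2)" by simp
    moreover have "?c * (real J * d + ?S) \<le> ?c * (e / 2 + ?S)"
      using d by (intro mult_left_mono) auto
    ultimately have "(\<Sum>l\<in>{n..m}. (norm (row_function l))\<^sup>2) \<le> ?c * (?S + e)"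
      using bound[OF nm] by (simp add: distrib_left)
    then have "(\<Sum>l\<in>{n..m}. (norm (row_function l))\<^sup>2) / ?c \<le> ?S + e"
      using c0 by (simp add: divide_le_eq mult.commute)
    then show "row_average M {n..m} \<le> ennreal (?S + e)"
      by (intro order.trans[OF row_average_le[OF nm]] ennreal_leI)
  qed
  then have "(INF N. X N) \<le> ennreal (?S + e)" by (rule INF_lower2[OF UNIV_I])
  then show "limsup_row_average M \<le> ennreal ?S + ennreal e"
    using S e by (simp add: lim ennreal_plus)
qed

end

theorem proposition8p1:
  fixes W :: "l2_torus \<Rightarrow> l2_torus" and M :: "int \<Rightarrow> int \<Rightarrow> complex"
  assumes "diagonal_type W M"
  shows "ennreal ((mu_norm W)\<^sup>2) \<ge> limsup_row_average M"
proof -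
  \<comment> \<open>The one-set partition serves twice: it shows that the average is finite, hence a
    real number, and that the infimum in \<open>mu_norm\<close> is over a nonempty set.\<close>
  have triv: "torus_partition 1 (\<lambda>_. {0..<2 * pi})"
    using sets.top[of torus] by (simp add: torus_partition_def lessThan_Suc)
  have "limsup_row_average M < top"
    using limsup_row_average_le[OF assms triv] ennreal_less_top le_less_trans by blast
  then obtain r where r: "r \<ge> 0" "limsup_row_average M = ennreal r"
    by (cases "limsup_row_average M") auto
  \<comment> \<open>\<open>mu_norm\<close> is an infimum of square roots, so the comparison is made
    for roots and squared only at the end.\<close>
  have "sqrt r \<le> mu_norm W"
    unfolding mu_norm_def
  proof (rule cINF_greatest)
    show "{(J, Y). torus_partition J Y} \<noteq> {}" using triv by blast
    fix P assume "P \<in> {(J, Y). torus_partition J Y}"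
    then obtain J Y where P: "P = (J, Y)" "torus_partition J Y" by auto
    have "partition_sum J Y W \<ge> 0" by (auto simp: partition_sum_def intro!: sum_nonneg)
    with limsup_row_average_le[OF assms P(2)] r
    show "sqrt r \<le> (case P of (J, Y) \<Rightarrow> sqrt (partition_sum J Y W))"
      by (simp add: P(1))
  qed
  from power_mono[OF this, of 2] r show ?thesis
    by (simp add: ennreal_leI)
qed

end
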